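(* Let $\mathcal{G}$ be a finite triangulation of the sphere whose faces are properly $2$-coloured black and white, and let $V=R\cup C\cup S$ be a proper vertex $3$-colouring (every triangle has exactly one vertex in each of $R,C,S$), with $R=\{r_1,\dots,r_k\}$. Define the $k\times k$ integer matrix $T=(t_{ij})$ by: for $i\neq j$, $t_{ij}$ is the number of edges $e$ with one end in $C$ and one in $S$ such that the white triangle containing $e$ has vertex $r_j$ and the black triangle containing $e$ has vertex $r_i$; and $t_{ii}=-\sum_{j\ne i}t_{ij}$. Let $\mathcal{B}_W$ be the abelian group generated by $x_1,\dots,x_k$ subject to $\sum_{j=1}^k t_{ij}x_j=0$ for $1\le i\le k$. Let $D$ be the directed multigraph on vertices $z_1,\dots,z_k$ with exactly $t_{ij}$ directed edges from $z_j$ to $z_i$ for each $i\neq j$, and let $d$ be the tree number of $D$. Then $d\neq 0$, and $\mathcal{B}_W\cong\mathbb{Z}\oplus\mathcal{C}$ where $\mathcal{C}$ is a finite abelian group of order $d$ (namely $\mathcal{C}$ is the kernel of the homomorphism $\mathcal{B}_W\to\mathbb{Z}$, $\sum_i a_ix_i\mapsto\sum_i a_i$).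
   Context: A triangulation of the sphere is a $2$-cell embedding of a finite graph (multiple edges allowed, no loops) in the sphere in which every face is bounded by a $3$-cycle with three distinct vertices; "properly $2$-coloured" means no two faces of the same colour share an edge. An arborescence in $D$ diverging from a vertex $z$ is a directed subtree of $D$ containing $z$ with all edges oriented away from $z$. The tree number of $D$ is the number of spanning arborescences of $D$ diverging from $z$; for the digraph $D$ here this number does not depend on the choice of the vertex $z$. *)

theory Defs
  imports
    "HOL-Analysis.Analysis"
    "HOL-Algebra.Free_Abelian_Groups"
    "HOL-Algebra.Generated_Groups"
    "Graph_Theory.Digraph_Component"
begin

abbreviation S2 :: "(real^3) set"
  where "S2 \<equiv> sphere 0 1"

text \<open>
  An edge is represented by its point set.  Distinct edges of an embedding have disjoint
  interiors, so parallel edges are still distinct elements of \<open>E\<close>.  The ends of an edge \<open>e\<close> are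
  the two points of \<open>e \<inter> V\<close>; they are different because an arc is injective, hence no loops.
\<close>

definition embedded_graph :: "(real^3) set \<Rightarrow> (real^3) set set \<Rightarrow> bool"
  where "embedded_graph V E \<longleftrightarrow>
    finite V \<and> V \<subseteq> S2 \<and> finite E \<and>
    (\<forall>e\<in>E. \<exists>g. Path_Connected.arc g \<and> path_image g = e \<and> e \<subseteq> S2 \<and>
                e \<inter> V = {pathstart g, pathfinish g}) \<and>
    (\<forall>e\<in>E. \<forall>f\<in>E. e \<noteq> f \<longrightarrow> e \<inter> f \<subseteq> V)"

definition embedding_faces :: "(real^3) set \<Rightarrow> (real^3) set set \<Rightarrow> (real^3) set set"
  where "embedding_faces V E = components (S2 - (V \<union> \<Union>E))"

definition two_cell_embedding :: "(real^3) set \<Rightarrow> (real^3) set set \<Rightarrow> bool"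
  where "two_cell_embedding V E \<longleftrightarrow>
    embedded_graph V E \<and> (\<forall>F\<in>embedding_faces V E. F homeomorphic ball (0::real^2) 1)"

definition face_boundary :: "(real^3) set \<Rightarrow> (real^3) set"
  where "face_boundary F = top_of_set S2 frontier_of F"

definition face_verts :: "(real^3) set \<Rightarrow> (real^3) set \<Rightarrow> (real^3) set"
  where "face_verts V F = V \<inter> face_boundary F"

definition face_edges :: "(real^3) set set \<Rightarrow> (real^3) set \<Rightarrow> (real^3) set set"
  where "face_edges E F = {e \<in> E. e \<subseteq> face_boundary F}"

definition sphere_triangulation :: "(real^3) set \<Rightarrow> (real^3) set set \<Rightarrow> bool"
  where "sphere_triangulation V E \<longleftrightarrow>
    two_cell_embedding V E \<and>
    (\<forall>F\<in>embedding_faces V E. \<exists>u v w. \<exists>e\<^sub>1\<in>E. \<exists>e\<^sub>2\<in>E. \<exists>e\<^sub>3\<in>E.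
       distinct [u, v, w] \<and>
       e\<^sub>1 \<inter> V = {u, v} \<and> e\<^sub>2 \<inter> V = {v, w} \<and> e\<^sub>3 \<inter> V = {w, u} \<and>
       face_boundary F = e\<^sub>1 \<union> e\<^sub>2 \<union> e\<^sub>3)"

definition proper_face_2_colouring ::
  "(real^3) set \<Rightarrow> (real^3) set set \<Rightarrow> (real^3) set set \<Rightarrow> (real^3) set set \<Rightarrow> bool"
  where "proper_face_2_colouring V E Wh Bl \<longleftrightarrow>
    Wh \<union> Bl = embedding_faces V E \<and> Wh \<inter> Bl = {} \<and>
    (\<forall>X\<in>{Wh, Bl}. \<forall>F\<in>X. \<forall>F'\<in>X. F \<noteq> F' \<longrightarrow> face_edges E F \<inter> face_edges E F' = {})"

definition proper_vertex_3_colouring ::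
  "(real^3) set \<Rightarrow> (real^3) set set \<Rightarrow>
     (real^3) set \<Rightarrow> (real^3) set \<Rightarrow> (real^3) set \<Rightarrow> bool"
  where "proper_vertex_3_colouring V E R C S \<longleftrightarrow>
    V = R \<union> C \<union> S \<and> R \<inter> C = {} \<and> R \<inter> S = {} \<and> C \<inter> S = {} \<and>
    (\<forall>e\<in>E. \<forall>X\<in>{R, C, S}. \<not> e \<inter> V \<subseteq> X) \<and>
    (\<forall>F\<in>embedding_faces V E. \<forall>X\<in>{R, C, S}. \<exists>!v. v \<in> X \<and> v \<in> face_verts V F)"

text \<open>
  By properness of the colouring an edge lies on at most one white and at most one black face,
  so the existential quantifiers below speak about the white and the black triangle at \<open>e\<close>.
\<close>

definition t_count ::
  "(real^3) set \<Rightarrow> (real^3) set set \<Rightarrow> (real^3) set set \<Rightarrow> (real^3) set set \<Rightarrow>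
     (real^3) set \<Rightarrow> (real^3) set \<Rightarrow> (nat \<Rightarrow> real^3) \<Rightarrow> nat \<Rightarrow> nat \<Rightarrow> nat"
  where "t_count V E Wh Bl C S r i j =
    card {e \<in> E. e \<inter> C \<noteq> {} \<and> e \<inter> S \<noteq> {} \<and>
            (\<exists>F\<in>Wh. e \<in> face_edges E F \<and> r j \<in> face_verts V F) \<and>
            (\<exists>F\<in>Bl. e \<in> face_edges E F \<and> r i \<in> face_verts V F)}"

definition t_matrix :: "nat \<Rightarrow> (nat \<Rightarrow> nat \<Rightarrow> nat) \<Rightarrow> nat \<Rightarrow> nat \<Rightarrow> int"
  where "t_matrix k n i j =
    (if i = j then - (\<Sum>l\<in>{1..k} - {i}. int (n i l)) else int (n i j))"

definition relation_subgroup :: "nat \<Rightarrow> (nat \<Rightarrow> nat \<Rightarrow> int) \<Rightarrow> (nat \<Rightarrow>\<^sub>0 int) set"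
  where "relation_subgroup k t =
    generate (free_Abelian_group {1..k})
      ((\<lambda>i. \<Sum>j=1..k. frag_cmul (t i j) (frag_of j)) ` {1..k})"

definition presented_group :: "nat \<Rightarrow> (nat \<Rightarrow> nat \<Rightarrow> int) \<Rightarrow> (nat \<Rightarrow>\<^sub>0 int) set monoid"
  where "presented_group k t = free_Abelian_group {1..k} Mod relation_subgroup k t"

text \<open>\<open>(i, j, m)\<close> is the \<open>m\<close>-th of the \<open>n i j\<close> parallel arcs from \<open>j\<close> to \<open>i\<close>.\<close>

definition count_digraph :: "nat \<Rightarrow> (nat \<Rightarrow> nat \<Rightarrow> nat) \<Rightarrow> (nat, nat \<times> nat \<times> nat) pre_digraph"
  where "count_digraph k n =
    \<lparr> verts = {1..k},
      arcs = {(i, j, m). i \<in> {1..k} \<and> j \<in> {1..k} \<and> i \<noteq> j \<and> m < n i j},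
      tail = (\<lambda>(i, j, m). j),
      head = (\<lambda>(i, j, m). i) \<rparr>"

text \<open>
  Walks in the underlying undirected multigraph of \<open>G\<close> are directed walks in \<open>both_ways G\<close>,
  where \<open>(a, True)\<close> traverses \<open>a\<close> forwards and \<open>(a, False)\<close> backwards.
\<close>

definition both_ways :: "('a, 'b) pre_digraph \<Rightarrow> ('a, 'b \<times> bool) pre_digraph"
  where "both_ways G =
    \<lparr> verts = verts G,
      arcs = arcs G \<times> UNIV,
      tail = (\<lambda>(a, fwd). if fwd then tail G a else head G a),
      head = (\<lambda>(a, fwd). if fwd then head G a else tail G a) \<rparr>"

text \<open>
  The predicate \<^const>\<open>Digraph_Component.tree\<close> excludes only directed cycles, so it cannot be
  used here.
\<close>

definition undirected_tree :: "('a, 'b) pre_digraph \<Rightarrow> bool"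
  where "undirected_tree G \<longleftrightarrow>
    Digraph_Component.connected G \<and>
    \<not> (\<exists>p. pre_digraph.cycle (both_ways G) p \<and> distinct (map fst p))"

text \<open>All arcs point away from \<open>z\<close>: every path starting in \<open>z\<close> uses its arcs forwards only.\<close>

definition arborescence_from :: "'a \<Rightarrow> ('a, 'b) pre_digraph \<Rightarrow> bool"
  where "arborescence_from z H \<longleftrightarrow>
    undirected_tree H \<and> z \<in> verts H \<and>
    (\<forall>v p. pre_digraph.apath (both_ways H) z p v \<longrightarrow> (\<forall>s\<in>set p. snd s))"

definition tree_number :: "('a, 'b) pre_digraph \<Rightarrow> 'a \<Rightarrow> nat"
  where "tree_number D z = card {H. spanning H D \<and> arborescence_from z H}"

end

theory Submission
  imports "Jordan_Normal_Form.Determinant" Defs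
begin

text \<open>
  The boundary of a triangle \<open>F\<close> is a Jordan curve and \<open>F\<close> is one of its two sides, so every edge also lies on a
  triangle on the other side; hence it lies on exactly one white and one black triangle. Counting the triangles
  at \<open>r\<^sub>i\<close> of either colour by their edges joining \<open>r\<^sub>i\<close> to \<open>C\<close> shows that \<open>D\<close> has equal in- and out-degree at every
  vertex, and since the sphere minus finitely many points is connected, so is \<open>D\<close>. Thus the columns of \<open>T\<close> sum to
  zero like its rows, so row \<open>z\<close> is redundant, and the kernel of the coefficient sum maps isomorphically onto
  \<open>\<int>\<^sup>k\<close> modulo the rows of \<open>T\<close> and the unit vector at \<open>z\<close>. The order of that quotient is the absolute value of the determinant of the
  Laplacian with row \<open>z\<close> replaced by the unit vector. By multilinearity this determinant is a sum over all choices
  of one arc into every vertex other than \<open>z\<close>, in which an arborescence contributes 1 and every other choice 0.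
  It is nonzero by the maximum principle.
\<close>

text \<open>The hypotheses do not say how many faces meet at an edge; this has to come out of the
  topology. Projection from a point of \<open>F\<close> turns the boundary of \<open>F\<close> into
  a closed curve in the plane, where the Jordan curve theorem applies. Connectivity of
  \<open>D\<close> yields some arc across every cut. The maximum principle asks for an arc that
  enters a given set of nodes, and balance turns the one into the other. Balance is used a second
  time in the algebra: an arborescence from \<open>z\<close> involves only arcs into the other
  nodes, hence only the other rows of \<open>T\<close>, while \<open>B\<^sub>W\<close> is presented
  by all rows. The unit row at \<open>z\<close> replaces the usual deletion of row and column
  \<open>z\<close>; the determinant is the same and the nodes keep their numbers. Since neither
  \<open>B\<^sub>W\<close> nor the coefficient sum mentions \<open>z\<close>, the computed order
  also shows that the tree number is the same for every root.\<close>

hide_const (open) Digraph_Component.connected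

section \<open>Triangulations of the sphere\<close>

text \<open>The plane is taken as \<open>complex\<close>, the type in which
  \<open>Jordan_inside_outside\<close> is stated.\<close>

lemma punctured_S2_homeomorphism:
  assumes "p \<in> S2"
  obtains h k where "homeomorphism (S2 - {p}) (UNIV :: complex set) h k"
proof -
  have "S2 - {p} homeomorphic (UNIV :: complex set)"
    by (rule homeomorphic_punctured_sphere_affine) (use assms in auto)
  then show thesis
    using that unfolding homeomorphic_def by blast
qed

lemma S2_antipode_neq: "p \<in> S2 \<Longrightarrow> - p \<noteq> p"
  by (metis dist_0_norm mem_sphere_0 neg_equal_iff_equal norm_zero real_vector.scale_minus_left
      scaleR_left.minus zero_neq_one neg_eq_iff_add_eq_0 scaleR_2 scaleR_eq_0_iff zero_neq_numeral)

lemma openin_S2_imp_open_image: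
  assumes "homeomorphism (S2 - {p}) (UNIV :: complex set) h k"
    and "openin (top_of_set S2) U" "p \<notin> U"
  shows "open (h ` U)"
proof -
  have "openin (top_of_set (S2 - {p})) U"
  proof (rule openin_subset_trans[OF assms(2)])
    show "U \<subseteq> S2 - {p}" using assms(2,3) by (auto dest: openin_imp_subset)
  qed auto
  then show ?thesis
    using homeomorphism_imp_open_map[OF assms(1)] by auto
qed

text \<open>A planar chart followed by the inverse of the arc's parametrization would map a nonempty
  open set of the plane continuously and injectively into the reals, against invariance of
  dimension.\<close>

lemma arc_in_S2_nowhere_dense:
  assumes g: "Path_Connected.arc g" and U: "openin (top_of_set S2) U" "U \<subseteq> path_image g"
  shows "U = {}"
proof (rule ccontr)
  assume "U \<noteq> {}"
  then obtain u where u: "u \<in> U" by auto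
  have US: "U \<subseteq> S2" using U(1) by (simp add: openin_imp_subset)
  then have nu: "norm u = 1" using u by auto
  \<comment> \<open>The antipode is a point of the sphere other than \<open>u\<close>, so puncturing
    there keeps \<open>u\<close> in the chart.\<close>
  define p where "p = - u"
  have p: "p \<in> S2" "u \<noteq> p" using nu S2_antipode_neq[of u] by (auto simp: p_def)
  obtain h k where hk: "homeomorphism (S2 - {p}) (UNIV :: complex set) h k"
    using punctured_S2_homeomorphism[OF p(1)] .
  define U' where "U' = U - {p}"
  have U': "openin (top_of_set S2) U'" "p \<notin> U'" "u \<in> U'"
    using U u p by (auto simp: U'_def openin_delete)
  have op: "open (h ` U')" by (rule openin_S2_imp_open_image[OF hk U'(1,2)])
  have khu: "k ` h ` U' = U'"
  proof -
    have "U' \<subseteq> S2 - {p}" using US by (auto simp: U'_def)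
    then show ?thesis using homeomorphism_apply1[OF hk] by (force simp: image_iff)
  qed
  obtain f where f: "homeomorphism {0..1} (path_image g) g f"
    using homeomorphism_arc[OF g] .
  have U'g: "U' \<subseteq> path_image g" using U(2) by (auto simp: U'_def)
  have "continuous_on (h ` U') (f \<circ> k)"
  proof (rule continuous_on_compose)
    show "continuous_on (h ` U') k"
      using homeomorphism_cont2[OF hk] continuous_on_subset by blast
    show "continuous_on (k ` h ` U') f"
      unfolding khu using homeomorphism_cont2[OF f] continuous_on_subset U'g by blast
  qed
  moreover have "inj_on (f \<circ> k) (h ` U')"
  proof (rule comp_inj_on)
    show "inj_on k (h ` U')"
      using homeomorphism_apply2[OF hk] by (metis UNIV_I inj_onI)
    show "inj_on f (k ` h ` U')"
      unfolding khu using homeomorphism_apply2[OF f] U'g by (metis inj_onI subsetD)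
  qed
  moreover have "h ` U' \<noteq> {}" using U' by auto
  ultimately have "DIM(complex) \<le> DIM(real)"
    using invariance_of_dimension[OF _ op] by blast
  then show False by simp
qed

section \<open>The embedded graph and its skeleton\<close>

locale triangulated_sphere =
  fixes V :: "(real^3) set" and E :: "(real^3) set set"
  assumes triangulation: "sphere_triangulation V E"
begin

abbreviation "faces \<equiv> embedding_faces V E"
abbreviation "skel \<equiv> V \<union> \<Union>E"

lemma embedded: "embedded_graph V E"
  using triangulation by (simp add: sphere_triangulation_def two_cell_embedding_def)

lemma finite_V: "finite V" and finite_E: "finite E" and V_sub: "V \<subseteq> S2"
  using embedded by (auto simp: embedded_graph_def)

lemma edge_arc:
  assumes "e \<in> E"
  obtains g where "Path_Connected.arc g" "path_image g = e" "e \<subseteq> S2" "e \<inter> V = {pathstart g, pathfinish g}"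
  using embedded assms unfolding embedded_graph_def by meson

lemma edges_meet_in_V: "\<lbrakk>e \<in> E; f \<in> E; x \<in> e; x \<in> f; x \<notin> V\<rbrakk> \<Longrightarrow> e = f"
  using embedded unfolding embedded_graph_def by blast

lemma edge_sub: "e \<in> E \<Longrightarrow> e \<subseteq> S2"
  using edge_arc by metis

lemma closed_edge: "e \<in> E \<Longrightarrow> closed e"
  using edge_arc closed_arc_image by metis

text \<open>By \<open>edges_meet_in_V\<close> a point off \<open>V\<close> lies on at most one edge.
  Later arguments follow an edge through such a point.\<close>

lemma edge_inner_point:
  assumes "e \<in> E"
  obtains x where "x \<in> e" "x \<notin> V"
proof -
  obtain g where g: "Path_Connected.arc g" "path_image g = e" "e \<inter> V = {pathstart g, pathfinish g}"
    using edge_arc[OF assms] by metis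
  have inj: "inj_on g {0..1}" using g by (simp add: arc_def)
  have "g (1/2) \<noteq> g 0" "g (1/2) \<noteq> g 1"
    using inj_on_eq_iff[OF inj, of "1/2" 0] inj_on_eq_iff[OF inj, of "1/2" 1] by auto
  moreover have "g (1/2) \<in> e" using g by (auto simp: path_image_def)
  ultimately show thesis using that[of "g (1/2)"] g(3) by (auto simp: pathstart_def pathfinish_def)
qed

lemma closed_skel: "closed skel"
  using finite_V finite_E closed_edge by (intro closed_Un finite_imp_closed closed_Union) auto

text \<open>Edges and single vertices are removed from \<open>U\<close> one at a time. Each is
  closed with empty interior in the sphere, so a nonempty open set always remains.\<close>

lemma openin_S2_Diff_skel:
  assumes "openin (top_of_set S2) U" "U \<noteq> {}"
  shows "U - skel \<noteq> {}"
proof -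
  have step: "\<exists>W. openin (top_of_set S2) W \<and> W \<noteq> {} \<and> W \<subseteq> U \<and> W \<inter> \<Union>D = {}"
    if "finite D" "D \<subseteq> E \<union> (\<lambda>x. {x}) ` V" for D
    using that
  proof (induction D)
    case empty
    then show ?case using assms by auto
  next
    case (insert e D)
    then obtain W where W: "openin (top_of_set S2) W" "W \<noteq> {}" "W \<subseteq> U" "W \<inter> \<Union>D = {}"
      by auto
    have cl: "closed e" using insert.prems closed_edge by auto
    have "openin (top_of_set S2) (W - e)"
      using W(1) cl by (metis Diff_eq open_Compl openin_Int_open)
    moreover have "W - e \<noteq> {}"
    proof
      assume "W - e = {}"
      then have We: "W \<subseteq> e" by auto
      consider "e \<in> E" | v where "e = {v}" using insert.prems by auto
      then show False
      proof cases
        case 1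
        then obtain g where "Path_Connected.arc g" "path_image g = e" using edge_arc by metis
        then show False using arc_in_S2_nowhere_dense W We by metis
      next
        case 2
        then have "openin (top_of_set S2) {v}" using W We by (metis subset_singletonD)
        moreover have "v \<in> S2" using 2 We W by (metis openin_imp_subset subset_singletonD singletonI subsetD)
        ultimately obtain T where T: "open T" "{v} = S2 \<inter> T" "v \<in> S2"
          by (metis openin_open)
        \<comment> \<open>A connected set with a second point, here the antipode, has no isolated
          points, so \<open>{v}\<close> is not open.\<close>
        have "connected S2" by (rule connected_sphere) simp
        moreover have "- v \<in> S2" "- v \<noteq> v" using T(3) S2_antipode_neq by auto
        ultimately have "v islimpt S2"
          using connected_imp_perfect[of S2 v] T(3) by (metis singletonD)
        then obtain y where "y \<in> S2" "y \<in> T" "y \<noteq> v"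
          using T by (metis Int_iff islimptE singletonI)
        then have False using T(2) by blast
        then show False by blast
      qed
    qed
    ultimately show ?case using W by (intro exI[of _ "W - e"]) auto
  qed
  have "finite (E \<union> (\<lambda>x. {x}) ` V)" using finite_V finite_E by auto
  from step[OF this order_refl] obtain W where
    "W \<noteq> {}" "W \<subseteq> U" "W \<inter> \<Union>(E \<union> (\<lambda>x. {x}) ` V) = {}" by auto
  then show ?thesis by blast
qed

end

text \<open>This compares the two ways to cut the complement of the boundary curve of a face:
  \<open>A\<close> and \<open>B\<close> come from the face and the rest of the sphere,
  \<open>I\<close> and \<open>U\<close> are the sides of the curve.\<close>

lemma two_partitions_eq:
  assumes "A \<union> B = I \<union> U" "A \<inter> B = {}" "I \<inter> U = {}" "A \<noteq> {}" "I \<noteq> {}" "U \<noteq> {}"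
    and "A \<subseteq> I \<or> A \<subseteq> U" "I \<subseteq> A \<or> I \<subseteq> B" "U \<subseteq> A \<or> U \<subseteq> B"
  shows "B = I \<or> B = U"
proof (cases "A \<subseteq> I")
  case True
  then have "U \<subseteq> B" using assms by auto
  moreover have "I \<subseteq> A" using assms True by auto
  ultimately have "B = U" using assms True by auto
  then show ?thesis ..
next
  case False
  then have A: "A \<subseteq> U" using assms by auto
  then have "I \<subseteq> B" using assms by auto
  moreover have "U \<subseteq> A" using assms A by auto
  ultimately have "B = I" using assms A by auto
  then show ?thesis ..
qed

section \<open>Faces and their boundary curves\<close>

context triangulated_sphere begin

lemma openin_Diff_skel: "openin (top_of_set S2) U \<Longrightarrow> openin (top_of_set S2) (U - skel)"
  by (metis Diff_eq closed_skel open_Compl openin_Int_open)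

lemma openin_face:
  assumes "F \<in> faces"
  shows "openin (top_of_set S2) F"
proof -
  have op: "openin (top_of_set S2) (S2 - skel)"
    by (rule openin_Diff_skel) auto
  have "locally connected (S2 - skel)"
    by (rule locally_open_subset[OF _ op]) (rule locally_connected_sphere)
  then have "openin (top_of_set (S2 - skel)) F"
    using assms openin_components_locally_connected unfolding embedding_faces_def by blast
  then show ?thesis using op openin_trans by blast
qed

lemma face_nonempty: "F \<in> faces \<Longrightarrow> F \<noteq> {}"
  unfolding embedding_faces_def by (rule in_components_nonempty)

lemma face_sub: "F \<in> faces \<Longrightarrow> F \<subseteq> S2 - skel"
  unfolding embedding_faces_def by (rule in_components_subset)

lemma faces_disjoint: "\<lbrakk>F \<in> faces; F' \<in> faces; F \<noteq> F'\<rbrakk> \<Longrightarrow> F \<inter> F' = {}"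
  unfolding embedding_faces_def using components_nonoverlap by metis

lemma Union_faces: "\<Union>faces = S2 - skel"
  unfolding embedding_faces_def by (rule Union_components)

text \<open>The sphere is closed and \<open>F\<close> is open in it, so the relative frontier can be
  computed with the closure in the ambient space.\<close>

lemma face_boundary_eq:
  assumes "F \<in> faces"
  shows "face_boundary F = closure F - F"
proof -
  have F: "openin (top_of_set S2) F" "F \<subseteq> S2" using openin_face[OF assms] face_sub[OF assms] by auto
  have "closure F \<subseteq> S2" using F(2) by (simp add: closure_minimal)
  then have "top_of_set S2 closure_of F = closure F"
    using F(2) by (simp add: closure_of_subtopology Int_absorb1 Int_absorb2 inf_absorb2)
  moreover have "top_of_set S2 interior_of F = F" using F(1) interior_of_openin by blast
  ultimately show ?thesis by (simp add: face_boundary_def frontier_of_def)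
qed

lemma face_triangle:
  assumes "F \<in> faces"
  obtains u v w e1 e2 e3 where "e1 \<in> E" "e2 \<in> E" "e3 \<in> E" "distinct [u, v, w]"
    "e1 \<inter> V = {u, v}" "e2 \<inter> V = {v, w}" "e3 \<inter> V = {w, u}" "face_boundary F = e1 \<union> e2 \<union> e3"
proof -
  have "\<exists>u v w. \<exists>e1\<in>E. \<exists>e2\<in>E. \<exists>e3\<in>E. distinct [u, v, w] \<and>
       e1 \<inter> V = {u, v} \<and> e2 \<inter> V = {v, w} \<and> e3 \<inter> V = {w, u} \<and> face_boundary F = e1 \<union> e2 \<union> e3"
    using triangulation assms unfolding sphere_triangulation_def by simp
  then show thesis
    by (elim exE bexE conjE) (rule that)
qed

lemma edge_arc_between:
  assumes "e \<in> E" "e \<inter> V = {u, v}"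
  obtains g where "Path_Connected.arc g" "path_image g = e" "pathstart g = u" "pathfinish g = v"
proof -
  obtain g where g: "Path_Connected.arc g" "path_image g = e" "e \<inter> V = {pathstart g, pathfinish g}"
    using edge_arc[OF assms(1)] by metis
  then consider "pathstart g = u" "pathfinish g = v" | "pathstart g = v" "pathfinish g = u"
    using assms(2) by (metis doubleton_eq_iff)
  then show thesis
  proof cases
    case 1 then show ?thesis using g that by blast
  next
    case 2 then show ?thesis using g that[of "reversepath g"] by (simp add: arc_reversepath)
  qed
qed

text \<open>The corners are distinct, so the three edges are different and two of them meet only in
  their common corner.\<close>

lemma face_boundary_loop:
  assumes "F \<in> faces"
  obtains c where "simple_path c" "pathfinish c = pathstart c" "path_image c = face_boundary F"
proof -
  obtain u v w e1 e2 e3 where e: "e1 \<in> E" "e2 \<in> E" "e3 \<in> E" "distinct [u, v, w]"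
    "e1 \<inter> V = {u, v}" "e2 \<inter> V = {v, w}" "e3 \<inter> V = {w, u}" "face_boundary F = e1 \<union> e2 \<union> e3"
    using face_triangle[OF assms] .
  obtain g1 where g1: "Path_Connected.arc g1" "path_image g1 = e1" "pathstart g1 = u" "pathfinish g1 = v"
    using edge_arc_between e by metis
  obtain g2 where g2: "Path_Connected.arc g2" "path_image g2 = e2" "pathstart g2 = v" "pathfinish g2 = w"
    using edge_arc_between e by metis
  obtain g3 where g3: "Path_Connected.arc g3" "path_image g3 = e3" "pathstart g3 = w" "pathfinish g3 = u"
    using edge_arc_between e by metis
  have "e1 \<noteq> e2" "e1 \<noteq> e3" "e2 \<noteq> e3" using e by (auto simp: doubleton_eq_iff)
  then have meet: "e1 \<inter> e2 \<subseteq> V" "e1 \<inter> e3 \<subseteq> V" "e2 \<inter> e3 \<subseteq> V"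
    using edges_meet_in_V e by blast+
  have "e1 \<inter> e2 \<subseteq> {u, v} \<inter> {v, w}" using meet(1) e(5,6) by blast
  then have 12: "e1 \<inter> e2 \<subseteq> {v}" using e(4) by auto
  have a: "Path_Connected.arc (g1 +++ g2)"
    by (rule arc_join) (use g1 g2 12 in auto)
  have "e1 \<inter> e3 \<subseteq> {u, v} \<inter> {w, u}" using meet(2) e(5,7) by blast
  moreover have "e2 \<inter> e3 \<subseteq> {v, w} \<inter> {w, u}" using meet(3) e(6,7) by blast
  ultimately have 3: "(e1 \<union> e2) \<inter> e3 \<subseteq> {u, w}" using e(4) by auto
  have "simple_path ((g1 +++ g2) +++ g3)"
    by (rule simple_path_join_loop) (use a g1 g2 g3 3 in \<open>auto simp: path_image_join\<close>)
  moreover have "path_image ((g1 +++ g2) +++ g3) = face_boundary F"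
    using g1 g2 g3 e by (simp add: path_image_join)
  moreover have "pathfinish ((g1 +++ g2) +++ g3) = pathstart ((g1 +++ g2) +++ g3)"
    using g1 g3 by simp
  ultimately show thesis using that by blast
qed

text \<open>Here the 2-cell condition enters: a disc stays connected when a point is removed. The
  point \<open>p\<close> will be the centre of projection.\<close>

lemma connected_punctured_face:
  assumes "F \<in> faces" "p \<in> F"
  shows "connected (F - {p})" "F - {p} \<noteq> {}"
proof -
  have "F homeomorphic ball (0::real^2) 1"
    using triangulation assms(1) by (simp add: sphere_triangulation_def two_cell_embedding_def)
  then have "ball (0::real^2) 1 homeomorphic F" by (rule homeomorphic_sym[THEN iffD1])
  then obtain f g where fg: "homeomorphism (ball (0::real^2) 1) F f g"
    unfolding homeomorphic_def by blast
  have g: "g p \<in> ball 0 1" "f (g p) = p"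
    using assms(2) homeomorphism_image2[OF fg] homeomorphism_apply2[OF fg] by (metis imageI)+
  have f_inj: "inj_on f (ball 0 1)" using homeomorphism_apply1[OF fg] by (metis inj_onI)
  have img: "F - {p} = f ` (ball 0 1 - {g p})"
    using homeomorphism_image1[OF fg] g inj_on_image_set_diff[OF f_inj, of "ball 0 1" "{g p}"]
    by simp
  have "connected (ball (0::real^2) 1 - {g p})"
    by (intro connected_open_delete) auto
  then show "connected (F - {p})"
    unfolding img using continuous_on_subset[OF homeomorphism_cont1[OF fg]]
    by (intro connected_continuous_image) auto
  have "ball (0::real^2) 1 \<noteq> {g p}"
    using not_open_singleton[of "g p"] open_ball[of "0::real^2" 1] by metis
  then have "ball (0::real^2) 1 - {g p} \<noteq> {}" using g(1) by blast
  then show "F - {p} \<noteq> {}" unfolding img by (simp only: image_is_empty not_False_eq_True)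
qed

text \<open>
  Seen from a point of \<open>F\<close>, the boundary of \<open>F\<close> is a Jordan curve in the plane, and \<open>F\<close> is one of its two sides.
\<close>

lemma other_side_of_face:
  assumes F: "F \<in> faces"
  defines "B \<equiv> S2 - closure F"
  shows "connected B" "face_boundary F \<subseteq> closure B"
proof -
  obtain p where p: "p \<in> F" using face_nonempty[OF F] by auto
  have FS: "F \<subseteq> S2" using face_sub[OF F] by blast
  have clFS: "closure F \<subseteq> S2" by (rule closure_minimal[OF FS]) simp
  define J where "J = face_boundary F"
  have J: "J = closure F - F" using face_boundary_eq[OF F] by (simp add: J_def)
  obtain h k where hk: "homeomorphism (S2 - {p}) (UNIV :: complex set) h k"
    using punctured_S2_homeomorphism p FS by blast
  have h_inj: "inj_on h (S2 - {p})" using homeomorphism_apply1[OF hk] by (metis inj_onI)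
  have kh: "k ` h ` X = X" if "X \<subseteq> S2 - {p}" for X
    using that homeomorphism_apply1[OF hk] by (force simp: image_iff)
  obtain c where c: "simple_path c" "pathfinish c = pathstart c" "path_image c = J"
    using face_boundary_loop[OF F] J_def by metis
  have JS: "J \<subseteq> S2 - {p}" using p clFS by (auto simp: J)
  have sc: "simple_path (h \<circ> c)"
    using simple_path_continuous_image[OF c(1)] c(3) JS homeomorphism_cont1[OF hk] h_inj
    by (metis continuous_on_subset inj_on_subset)
  have cl: "pathfinish (h \<circ> c) = pathstart (h \<circ> c)"
    using c(2) by (simp add: pathfinish_compose pathstart_compose)
  have im: "path_image (h \<circ> c) = h ` J" using c(3) by (simp add: path_image_compose)
  define I where "I = inside (h ` J)"
  define U where "U = outside (h ` J)"
  note Jordan = Jordan_inside_outside[OF sc cl, unfolded im, folded I_def U_def]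
  define A where "A = h ` (F - {p})"
  define B' where "B' = h ` B"
  have opA: "open A"
    unfolding A_def by (rule openin_S2_imp_open_image[OF hk]) (auto intro: openin_delete openin_face[OF F])
  have "openin (top_of_set S2) B"
    unfolding B_def by (metis Diff_eq closed_closure open_Compl openin_open_Int)
  moreover have "p \<notin> B" using p closure_subset by (auto simp: B_def)
  ultimately have opB: "open B'"
    unfolding B'_def by (rule openin_S2_imp_open_image[OF hk])
  have BS: "B \<subseteq> S2 - {p}" using \<open>p \<notin> B\<close> by (auto simp: B_def)
  have parts: "(F - {p}) \<union> B = (S2 - {p}) - J" "(F - {p}) \<inter> B = {}"
    using p FS closure_subset by (auto simp: B_def J)
  have AB: "A \<union> B' = - (h ` J)"
  proof -
    have "A \<union> B' = h ` ((S2 - {p}) - J)" unfolding A_def B'_def image_Un[symmetric] parts ..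
    also have "\<dots> = h ` (S2 - {p}) - h ` J" using inj_on_image_set_diff[OF h_inj _ JS] by simp
    also have "\<dots> = - (h ` J)" using homeomorphism_image1[OF hk] by auto
    finally show ?thesis .
  qed
  have "F - {p} \<subseteq> S2 - {p}" using FS by auto
  then have dis: "A \<inter> B' = {}"
    using parts(2) BS inj_on_image_Int[OF h_inj, of "F - {p}" B] by (simp add: A_def B'_def)
  have conA: "connected A" unfolding A_def
    by (rule connected_continuous_image[OF continuous_on_subset[OF homeomorphism_cont1[OF hk]]
          connected_punctured_face(1)[OF F p]]) (use FS in auto)
  have neA: "A \<noteq> {}" unfolding A_def using connected_punctured_face(2)[OF F p] by blast
  have IU: "open I" "open U" "I \<inter> U = {}" "I \<union> U = - (h ` J)" "connected I" "connected U"
     "I \<noteq> {}" "U \<noteq> {}" using Jordan by auto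
  have A: "A \<subseteq> I \<or> A \<subseteq> U"
    using connectedD[OF conA IU(1,2)] IU(3,4) AB by blast
  have I: "I \<subseteq> A \<or> I \<subseteq> B'"
    using connectedD[OF IU(5) opA opB] IU(4) AB dis by blast
  have U: "U \<subseteq> A \<or> U \<subseteq> B'"
    using connectedD[OF IU(6) opA opB] IU(4) AB dis by blast
  have "B' = I \<or> B' = U"
  proof -
    have "A \<union> B' = I \<union> U" using AB IU(4) by simp
    then show ?thesis
      by (rule two_partitions_eq) (fact dis IU(3) neA IU(7) IU(8) A I U)+
  qed
  \<comment> \<open>Each side of a Jordan curve has the whole curve as its frontier;
    \<open>k\<close> carries this back to the sphere.\<close>
  then have B': "connected B'" "frontier B' = h ` J" using Jordan by auto
  have cont: "continuous_on X k" for X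
    using continuous_on_subset[OF homeomorphism_cont2[OF hk]] by auto
  have "B = k ` B'" using kh[OF BS] by (simp add: B'_def)
  then show "connected B" using connected_continuous_image[OF cont B'(1)] by simp
  have "J = k ` h ` J" using kh[OF JS] by simp
  also have "\<dots> \<subseteq> k ` closure B'" using B'(2) by (auto simp: frontier_def)
  also have "\<dots> \<subseteq> closure (k ` B')"
    by (rule image_closure_subset[OF cont]) (auto simp: closure_subset)
  finally show "face_boundary F \<subseteq> closure B" using \<open>B = k ` B'\<close> by (simp add: J_def)
qed

text \<open>Within the connected set \<open>S2 - closure F\<close> the face \<open>G\<close> is
  open, and it is closed because its boundary lies in \<open>closure F\<close>. Being nonempty, it
  fills the set.\<close>

lemma face_with_same_boundary:
  assumes "F \<in> faces" "G \<in> faces" "face_boundary F = face_boundary G" "F \<noteq> G"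
  shows "G = S2 - closure F"
proof -
  let ?B = "S2 - closure F"
  have FG: "F \<inter> G = {}" using faces_disjoint assms by auto
  have bd: "closure F - F = closure G - G" using assms face_boundary_eq by auto
  have GB: "G \<subseteq> ?B" using FG bd face_sub[OF assms(2)] closure_subset by blast
  have opG: "openin (top_of_set ?B) G"
    using openin_subset_trans[OF openin_face[OF assms(2)] GB] by auto
  have "?B \<inter> closure G = G" using GB bd closure_subset by blast
  then have "closedin (top_of_set ?B) G" by (metis closed_closure closedin_closed_Int)
  moreover have "connected ?B" using other_side_of_face assms(1) by auto
  ultimately show ?thesis
    using opG face_nonempty[OF assms(2)] unfolding connected_clopen by blast
qed

text \<open>Only finitely many unions of three edges can be boundaries, and by the preceding lemma
  at most two faces share one. Finiteness makes unions of closed faces closed.\<close>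

lemma finite_faces: "finite faces"
proof -
  have "face_boundary ` faces \<subseteq> (\<lambda>(e1, e2, e3). e1 \<union> e2 \<union> e3) ` (E \<times> E \<times> E)"
  proof
    fix J assume "J \<in> face_boundary ` faces"
    then obtain F where F: "F \<in> faces" "J = face_boundary F" by blast
    obtain u v w e1 e2 e3 where "e1 \<in> E" "e2 \<in> E" "e3 \<in> E" "face_boundary F = e1 \<union> e2 \<union> e3"
      by (rule face_triangle[OF F(1)]) blast
    then show "J \<in> (\<lambda>(e1, e2, e3). e1 \<union> e2 \<union> e3) ` (E \<times> E \<times> E)"
      using F(2) by (intro image_eqI[of _ _ "(e1, e2, e3)"]) auto
  qed
  then have fin: "finite (face_boundary ` faces)"
    using finite_E by (meson finite_SigmaI finite_imageI finite_subset)
  have "finite {F \<in> faces. face_boundary F = J}" for J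
  proof (cases "\<exists>F\<in>faces. face_boundary F = J")
    case True
    then obtain F where "F \<in> faces" "face_boundary F = J" by auto
    then have "{F \<in> faces. face_boundary F = J} \<subseteq> {F, S2 - closure F}"
      using face_with_same_boundary by auto
    then show ?thesis by (rule finite_subset) simp
  next
    case False
    then have "{F \<in> faces. face_boundary F = J} = {}" by auto
    then show ?thesis by (metis finite.emptyI)
  qed
  then have "finite (\<Union>J\<in>face_boundary ` faces. {F \<in> faces. face_boundary F = J})"
    using fin by blast
  then show ?thesis by (rule rev_finite_subset) auto
qed

end

lemma ex1_in_three:
  assumes "(P a \<and> \<not> P b \<and> \<not> P c) \<or> (\<not> P a \<and> P b \<and> \<not> P c) \<or> (\<not> P a \<and> \<not> P b \<and> P c)"
  shows "\<exists>!x. x \<in> {a, b, c} \<and> P x"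
  using assms by (elim disjE conjE) auto

section \<open>Faces at edges and vertices\<close>

context triangulated_sphere begin

text \<open>The skeleton has empty interior, so \<open>x\<close> is a limit of points of
  \<open>B\<close> off the skeleton. These lie in finitely many faces, and one of them must
  accumulate at \<open>x\<close>. The set \<open>B\<close> lets the caller prescribe the side on
  which the face is sought.\<close>

lemma face_near_point:
  assumes "openin (top_of_set S2) B" "x \<in> closure B"
  obtains F where "F \<in> faces" "x \<in> closure F" "F \<inter> B \<noteq> {}"
proof -
  let ?\<F> = "{F \<in> faces. F \<inter> B \<noteq> {}}"
  have "x \<in> closure (B - skel)"
    unfolding closure_iff_nhds_not_empty
  proof (intro allI impI)
    fix A W assume W: "W \<subseteq> A" "open W" "x \<in> W"
    then have "B \<inter> W \<noteq> {}" using assms(2) by (metis closure_iff_nhds_not_empty order_refl)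
    moreover have "openin (top_of_set S2) (B \<inter> W)" using assms(1) W(2) by (rule openin_Int_open)
    ultimately have "B \<inter> W - skel \<noteq> {}" by (intro openin_S2_Diff_skel)
    then show "(B - skel) \<inter> A \<noteq> {}" using W(1) by blast
  qed
  moreover have "B - skel \<subseteq> \<Union>?\<F>"
  proof
    fix y assume y: "y \<in> B - skel"
    then have "y \<in> \<Union>faces" using Union_faces openin_imp_subset[OF assms(1)] by blast
    then show "y \<in> \<Union>?\<F>" using y by blast
  qed
  ultimately have "x \<in> closure (\<Union>?\<F>)" using closure_mono by blast
  moreover have "closure (\<Union>?\<F>) \<subseteq> (\<Union>F\<in>?\<F>. closure F)"
    using finite_faces closure_subset by (intro closure_minimal closed_UN) auto
  ultimately show thesis using that by blast
qed

text \<open>Being on an edge, \<open>x\<close> is on the boundary of \<open>F\<close> and so on one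
  of its three sides; being off \<open>V\<close>, it lies on no edge but \<open>e\<close>.\<close>

lemma face_edgeI:
  assumes "F \<in> faces" "e \<in> E" "x \<in> e" "x \<notin> V" "x \<in> closure F"
  shows "e \<in> face_edges E F"
proof -
  have "x \<notin> F" using face_sub[OF assms(1)] assms(2,3) by blast
  then have x: "x \<in> face_boundary F" using face_boundary_eq assms by auto
  obtain u v w e1 e2 e3 where e: "e1 \<in> E" "e2 \<in> E" "e3 \<in> E" "face_boundary F = e1 \<union> e2 \<union> e3"
    by (rule face_triangle[OF assms(1)]) blast
  then have "e = e1 \<or> e = e2 \<or> e = e3"
    using x edges_meet_in_V assms by blast
  then show ?thesis using e by (auto simp: face_edges_def)
qed

lemma two_faces_at_edge:
  assumes "e \<in> E"
  obtains F F' where "F \<in> faces" "F' \<in> faces" "F \<noteq> F'" "e \<in> face_edges E F" "e \<in> face_edges E F'"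
proof -
  obtain x where x: "x \<in> e" "x \<notin> V" using edge_inner_point[OF assms] .
  have xS: "x \<in> closure S2" using edge_sub[OF assms] x(1) by auto
  obtain F where F: "F \<in> faces" "x \<in> closure F"
    by (rule face_near_point[OF openin_subtopology_self xS]) 
  then have eF: "e \<in> face_edges E F" using face_edgeI assms x by blast
  \<comment> \<open>The second face is sought beyond the boundary curve of \<open>F\<close>.
    Whatever meets \<open>B\<close> differs from \<open>F\<close>.\<close>
  define B where "B = S2 - closure F"
  have "openin (top_of_set S2) B"
    unfolding B_def by (metis Diff_eq closed_closure open_Compl openin_open_Int)
  moreover have "x \<in> closure B"
    using other_side_of_face(2)[OF F(1)] eF x(1) unfolding B_def face_edges_def by blast
  ultimately obtain F' where F': "F' \<in> faces" "x \<in> closure F'" "F' \<inter> B \<noteq> {}"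
    by (rule face_near_point)
  then have "F \<noteq> F'" using closure_subset[of F] by (auto simp: B_def)
  moreover have "e \<in> face_edges E F'" using face_edgeI F' assms x by blast
  ultimately show thesis using that F(1) F'(1) eF by blast
qed

lemma face_at_vertex:
  assumes "v \<in> V"
  obtains F where "F \<in> faces" "v \<in> face_verts V F"
proof -
  have "v \<in> closure S2" using assms V_sub by auto
  then obtain F where F: "F \<in> faces" "v \<in> closure F"
    by (rule face_near_point[OF openin_subtopology_self]) 
  moreover have "v \<notin> F" using face_sub[OF F(1)] assms by blast
  ultimately show thesis using that assms face_boundary_eq[OF F(1)] by (auto simp: face_verts_def)
qed

text \<open>One vertex is the centre of projection; the others become finitely many points, which do
  not disconnect the plane.\<close>

lemma connected_S2_Diff_V:
  assumes "V \<noteq> {}"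
  shows "connected (S2 - V)"
proof -
  obtain p where p: "p \<in> V" using assms by auto
  then obtain h k where hk: "homeomorphism (S2 - {p}) (UNIV :: complex set) h k"
    using punctured_S2_homeomorphism V_sub by blast
  have "connected (UNIV - h ` (V - {p}))"
    using finite_V by (intro connected_open_diff_countable) (auto simp: uncountable_infinite countable_finite)
  then have "connected (k ` (UNIV - h ` (V - {p})))"
    by (intro connected_continuous_image continuous_on_subset[OF homeomorphism_cont2[OF hk]]) auto
  moreover have "k ` (UNIV - h ` (V - {p})) = S2 - V"
  proof -
    have "inj k" using homeomorphism_apply2[OF hk] by (metis UNIV_I injI)
    then have "k ` (UNIV - h ` (V - {p})) = k ` UNIV - k ` h ` (V - {p})"
      by (rule image_set_diff)
    also have "k ` UNIV = S2 - {p}" using homeomorphism_image2[OF hk] .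
    also have "k ` h ` (V - {p}) = V - {p}"
      using homeomorphism_apply1[OF hk] V_sub by (force simp: image_iff)
    finally show ?thesis using p by auto
  qed
  ultimately show ?thesis by simp
qed

end

section \<open>Face and vertex colourings\<close>

locale coloured_sphere = triangulated_sphere +
  fixes Wh Bl :: "(real^3) set set" and R C S :: "(real^3) set"
  assumes face_colouring: "proper_face_2_colouring V E Wh Bl"
    and vertex_colouring: "proper_vertex_3_colouring V E R C S"
begin

lemma Wh_Bl: "Wh \<union> Bl = faces" "Wh \<inter> Bl = {}"
  using face_colouring by (simp_all add: proper_face_2_colouring_def)

lemma colour_class_edges_disjoint:
  assumes "X \<in> {Wh, Bl}" "F \<in> X" "F' \<in> X" "e \<in> face_edges E F" "e \<in> face_edges E F'"
  shows "F = F'"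
proof (rule ccontr)
  assume "F \<noteq> F'"
  then have "face_edges E F \<inter> face_edges E F' = {}"
    using face_colouring assms(1-3) unfolding proper_face_2_colouring_def by blast
  then show False using assms by blast
qed

lemma face_of_colour_at_edge:
  assumes "X \<in> {Wh, Bl}" "e \<in> E"
  shows "\<exists>!F. F \<in> X \<and> e \<in> face_edges E F"
proof -
  obtain F F' where F: "F \<in> faces" "F' \<in> faces" "F \<noteq> F'" "e \<in> face_edges E F" "e \<in> face_edges E F'"
    using two_faces_at_edge[OF assms(2)] .
  have "F \<in> Wh \<or> F \<in> Bl" "F' \<in> Wh \<or> F' \<in> Bl" using F Wh_Bl by blast+
  then have "(F \<in> Wh \<and> F' \<in> Bl) \<or> (F' \<in> Wh \<and> F \<in> Bl)"
    using F colour_class_edges_disjoint[of Wh F F' e] colour_class_edges_disjoint[of Bl F F' e] by auto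
  then have "\<exists>F. F \<in> X \<and> e \<in> face_edges E F" using assms(1) F(4,5) by blast
  then show ?thesis using colour_class_edges_disjoint[OF assms(1)] by blast
qed

lemma vertex_classes: "V = R \<union> C \<union> S" "R \<inter> C = {}" "R \<inter> S = {}" "C \<inter> S = {}"
  using vertex_colouring by (simp_all only: proper_vertex_3_colouring_def)

lemma face_vertex_of_class:
  assumes "F \<in> faces" "X \<in> {R, C, S}"
  shows "\<exists>!v. v \<in> X \<and> v \<in> face_verts V F"
proof -
  have "\<forall>F\<in>faces. \<forall>X\<in>{R, C, S}. \<exists>!v. v \<in> X \<and> v \<in> face_verts V F"
    using vertex_colouring unfolding proper_vertex_3_colouring_def by (elim conjE)
  from bspec[OF bspec[OF this assms(1)] assms(2)] show ?thesis .
qed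

lemma edge_not_within_class:
  assumes "e \<in> E" "X \<in> {R, C, S}"
  shows "\<not> e \<inter> V \<subseteq> X"
proof -
  have "\<forall>e\<in>E. \<forall>X\<in>{R, C, S}. \<not> e \<inter> V \<subseteq> X"
    using vertex_colouring unfolding proper_vertex_3_colouring_def by (elim conjE)
  from bspec[OF bspec[OF this assms(1)] assms(2)] show ?thesis .
qed

lemma class_disjoint: "\<lbrakk>X \<in> {R, C, S}; Y \<in> {R, C, S}; X \<noteq> Y\<rbrakk> \<Longrightarrow> X \<inter> Y = {}"
  using vertex_classes by auto

lemma class_sub_V: "X \<in> {R, C, S} \<Longrightarrow> X \<subseteq> V"
  using vertex_classes by auto

definition joins :: "(real^3) set \<Rightarrow> (real^3) set \<Rightarrow> (real^3) set \<Rightarrow> bool"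
  where "joins X Y e \<longleftrightarrow> e \<inter> X \<noteq> {} \<and> e \<inter> Y \<noteq> {}"

text \<open>A triangle has one corner in each class, and any two of its corners are the ends of
  exactly one side.\<close>

lemma face_edge_joining:
  assumes F: "F \<in> faces" and X: "X \<in> {R, C, S}" and Y: "Y \<in> {R, C, S}" and XY: "X \<noteq> Y"
  shows "\<exists>!e. e \<in> face_edges E F \<and> joins X Y e"
proof -
  obtain u v w e1 e2 e3 where e: "e1 \<in> E" "e2 \<in> E" "e3 \<in> E" "distinct [u, v, w]"
    "e1 \<inter> V = {u, v}" "e2 \<inter> V = {v, w}" "e3 \<inter> V = {w, u}" "face_boundary F = e1 \<union> e2 \<union> e3"
    using face_triangle[OF F] .
  have fv: "face_verts V F = {u, v, w}"
  proof -
    have "face_verts V F = (e1 \<inter> V) \<union> (e2 \<inter> V) \<union> (e3 \<inter> V)" by (auto simp: face_verts_def e(8))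
    then show ?thesis unfolding e by auto
  qed
  \<comment> \<open>An edge covered by the three sides shares an inner point with one of them, hence
    equals it.\<close>
  have fe: "face_edges E F = {e1, e2, e3}"
  proof
    show "{e1, e2, e3} \<subseteq> face_edges E F" using e by (auto simp: face_edges_def)
    show "face_edges E F \<subseteq> {e1, e2, e3}"
    proof
      fix e assume e': "e \<in> face_edges E F"
      then have "e \<in> E" by (simp add: face_edges_def)
      then obtain x where "x \<in> e" "x \<notin> V" using edge_inner_point by blast
      moreover from this have "x \<in> e1 \<union> e2 \<union> e3" using e' e(8) by (auto simp: face_edges_def)
      ultimately show "e \<in> {e1, e2, e3}" using edges_meet_in_V \<open>e \<in> E\<close> e(1-3) by blast
    qed
  qed
  obtain x where x: "x \<in> X" "x \<in> {u, v, w}" and x_unique: "\<And>x'. x' \<in> X \<Longrightarrow> x' \<in> {u, v, w} \<Longrightarrow> x' = x"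
    using face_vertex_of_class[OF F X, unfolded fv] by (metis (no_types, lifting))
  obtain y where y: "y \<in> Y" "y \<in> {u, v, w}" and y_unique: "\<And>y'. y' \<in> Y \<Longrightarrow> y' \<in> {u, v, w} \<Longrightarrow> y' = y"
    using face_vertex_of_class[OF F Y, unfolded fv] by (metis (no_types, lifting))
  have "x \<noteq> y" using x y class_disjoint[OF X Y XY] by auto
  have j: "joins X Y e \<longleftrightarrow> {x, y} \<subseteq> e \<inter> V" if "e \<in> {e1, e2, e3}" for e
  proof -
    have "e \<inter> V \<subseteq> {u, v, w}" using that e(5-7) by auto
    then have "e \<inter> X \<noteq> {} \<longleftrightarrow> x \<in> e" "e \<inter> Y \<noteq> {} \<longleftrightarrow> y \<in> e"
      using x x_unique y y_unique class_sub_V[OF X] class_sub_V[OF Y] by blast+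
    then show ?thesis unfolding joins_def using x y class_sub_V[OF X] class_sub_V[OF Y] by auto
  qed
  have "\<exists>!e. e \<in> {e1, e2, e3} \<and> {x, y} \<subseteq> e \<inter> V"
  proof -
    have eqs: "({x, y} \<subseteq> e1 \<inter> V) = ({x, y} = {u, v})" "({x, y} \<subseteq> e2 \<inter> V) = ({x, y} = {v, w})"
      "({x, y} \<subseteq> e3 \<inter> V) = ({x, y} = {w, u})"
      unfolding e(5-7) using \<open>x \<noteq> y\<close> by auto
    have "{x, y} = {u, v} \<or> {x, y} = {v, w} \<or> {x, y} = {w, u}"
      using x(2) y(2) \<open>x \<noteq> y\<close> by auto
    moreover have "{u, v} \<noteq> {v, w}" "{u, v} \<noteq> {w, u}" "{v, w} \<noteq> {w, u}"
      using e(4) by (auto simp: doubleton_eq_iff)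
    ultimately show ?thesis
      by (intro ex1_in_three) (simp only: eqs, metis)
  qed
  moreover have "(e \<in> {e1, e2, e3} \<and> joins X Y e) = (e \<in> {e1, e2, e3} \<and> {x, y} \<subseteq> e \<inter> V)" for e
    using j by (rule conj_cong[OF refl])
  ultimately show ?thesis unfolding fe by (simp only:)
qed

text \<open>
  Sending a triangle of one colour to its edge joining \<open>X\<close> and \<open>Y\<close> is injective, so the count below does not
  depend on \<open>X\<close> and \<open>Y\<close>.
\<close>

lemma card_edges_joining_at_vertex:
  assumes K: "K \<in> {Wh, Bl}" and X: "X \<in> {R, C, S}" and Y: "Y \<in> {R, C, S}" and XY: "X \<noteq> Y"
  shows "card {e \<in> E. joins X Y e \<and> (\<exists>F\<in>K. e \<in> face_edges E F \<and> v \<in> face_verts V F)}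
    = card {F \<in> K. v \<in> face_verts V F}"
proof (rule sym, rule bij_betw_same_card)
  let ?f = "\<lambda>F. THE e. e \<in> face_edges E F \<and> joins X Y e"
  have KF: "K \<subseteq> faces" using K Wh_Bl by auto
  have f: "?f F \<in> face_edges E F" "joins X Y (?f F)" if "F \<in> K" for F
    using theI'[OF face_edge_joining[OF _ X Y XY]] that KF by blast+
  have f_unique: "e = ?f F" if "F \<in> K" "e \<in> face_edges E F" "joins X Y e" for e F
    using face_edge_joining[OF _ X Y XY] that f KF by blast
  show "bij_betw ?f {F \<in> K. v \<in> face_verts V F}
     {e \<in> E. joins X Y e \<and> (\<exists>F\<in>K. e \<in> face_edges E F \<and> v \<in> face_verts V F)}"
    unfolding bij_betw_def
  proof
    show "inj_on ?f {F \<in> K. v \<in> face_verts V F}"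
      using colour_class_edges_disjoint[OF K] f by (intro inj_onI) (metis (no_types, lifting) mem_Collect_eq)
    show "?f ` {F \<in> K. v \<in> face_verts V F}
      = {e \<in> E. joins X Y e \<and> (\<exists>F\<in>K. e \<in> face_edges E F \<and> v \<in> face_verts V F)}"
    proof (intro equalityI subsetI)
      fix e assume "e \<in> ?f ` {F \<in> K. v \<in> face_verts V F}"
      then obtain F where F: "e = ?f F" "F \<in> K" "v \<in> face_verts V F" by blast
      then have "e \<in> face_edges E F" "joins X Y e" using f by metis+
      then show "e \<in> {e \<in> E. joins X Y e \<and> (\<exists>F\<in>K. e \<in> face_edges E F \<and> v \<in> face_verts V F)}"
        using F(2,3) by (auto simp: face_edges_def)
    next
      fix e assume "e \<in> {e \<in> E. joins X Y e \<and> (\<exists>F\<in>K. e \<in> face_edges E F \<and> v \<in> face_verts V F)}"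
      then obtain F where F: "joins X Y e" "F \<in> K" "e \<in> face_edges E F" "v \<in> face_verts V F" by blast
      then show "e \<in> ?f ` {F \<in> K. v \<in> face_verts V F}"
        using f_unique by (intro image_eqI[of _ _ F]) auto
    qed
  qed
qed

text \<open>Every edge from \<open>v\<close> to \<open>C\<close> lies on exactly one triangle of
  colour \<open>K\<close>, and \<open>v\<close> is that triangle's only corner in \<open>R\<close>.
  The right-hand side is free of \<open>K\<close>, so \<open>v\<close> lies on equally many white
  and black triangles.\<close>

lemma card_faces_at_R_vertex:
  assumes K: "K \<in> {Wh, Bl}" and v: "v \<in> R"
  shows "card {F \<in> K. v \<in> face_verts V F} = card {e \<in> E. v \<in> e \<and> e \<inter> C \<noteq> {}}"
proof -
  have "e \<in> E \<Longrightarrow> joins R C e \<and> (\<exists>F\<in>K. e \<in> face_edges E F \<and> v \<in> face_verts V F) \<longleftrightarrow> v \<in> e \<and> e \<inter> C \<noteq> {}"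
    for e
  proof safe
    fix F x y assume F: "joins R C e" "F \<in> K" "e \<in> face_edges E F" "v \<in> face_verts V F"
    then obtain u where u: "u \<in> e" "u \<in> R" by (auto simp: joins_def)
    then have "u \<in> face_verts V F" using F(3) class_sub_V[of R] by (auto simp: face_verts_def face_edges_def)
    then have "u = v" using face_vertex_of_class[of F R] F(2,4) u(2) v K Wh_Bl by blast
    then show "v \<in> e" using u by simp
    assume "e \<inter> C = {}"
    then show False using F(1) by (simp add: joins_def)
  next
    fix y assume e: "e \<in> E" "v \<in> e" "y \<in> e" "y \<in> C"
    show "joins R C e" using e v by (auto simp: joins_def)
    obtain F where "F \<in> K" "e \<in> face_edges E F" using face_of_colour_at_edge[OF K e(1)] by blast
    moreover from this have "v \<in> face_verts V F"
      using e(2) v class_sub_V[of R] by (auto simp: face_verts_def face_edges_def)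
    ultimately show "\<exists>F\<in>K. e \<in> face_edges E F \<and> v \<in> face_verts V F" by blast
  qed
  then have "{e \<in> E. joins R C e \<and> (\<exists>F\<in>K. e \<in> face_edges E F \<and> v \<in> face_verts V F)}
    = {e \<in> E. v \<in> e \<and> e \<inter> C \<noteq> {}}" by blast
  moreover have "R \<noteq> C"
    using face_vertex_of_class[of _ R] vertex_classes(2) face_at_vertex[of v] v class_sub_V[of R] by blast
  ultimately show ?thesis using card_edges_joining_at_vertex[OF K, of R C v] by simp
qed

end

section \<open>Balance and connectivity of the counts\<close>

locale numbered_sphere = coloured_sphere +
  fixes r :: "nat \<Rightarrow> real^3" and k :: nat
  assumes numbering: "bij_betw r {1..k} R"
begin

abbreviation "n \<equiv> t_count V E Wh Bl C S r"

lemma r_in_R: "i \<in> {1..k} \<Longrightarrow> r i \<in> R"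
  using numbering by (rule bij_betwE[THEN bspec])

lemma r_inj: "\<lbrakk>r i = r j; i \<in> {1..k}; j \<in> {1..k}\<rbrakk> \<Longrightarrow> i = j"
  using numbering by (metis bij_betw_imp_inj_on inj_onD)

lemma R_vertex_index: "v \<in> R \<Longrightarrow> \<exists>i\<in>{1..k}. v = r i"
  using numbering by (auto simp: bij_betw_def)

lemma index_of_face:
  assumes "F \<in> faces"
  shows "\<exists>!i. i \<in> {1..k} \<and> r i \<in> face_verts V F"
proof -
  obtain v where v: "v \<in> R" "v \<in> face_verts V F" "\<And>u. u \<in> R \<Longrightarrow> u \<in> face_verts V F \<Longrightarrow> u = v"
    using face_vertex_of_class[OF assms, of R] by (metis insertI1)
  obtain i where "i \<in> {1..k}" "v = r i" using R_vertex_index[OF v(1)] by blast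
  then show ?thesis using v r_in_R r_inj by metis
qed

text \<open>Each edge lies on one triangle of colour \<open>K\<close>, which has one corner in
  \<open>R\<close>; so the sets for the different \<open>i\<close> partition the edges satisfying
  \<open>Q\<close>.\<close>

lemma sum_card_by_index:
  assumes K: "K \<in> {Wh, Bl}"
  shows "(\<Sum>i=1..k. card {e \<in> E. Q e \<and> (\<exists>F\<in>K. e \<in> face_edges E F \<and> r i \<in> face_verts V F)})
    = card {e \<in> E. Q e}"
proof -
  let ?A = "\<lambda>i. {e \<in> E. Q e \<and> (\<exists>F\<in>K. e \<in> face_edges E F \<and> r i \<in> face_verts V F)}"
  have KF: "K \<subseteq> faces" using K Wh_Bl by auto
  have "card (\<Union>i\<in>{1..k}. ?A i) = (\<Sum>i=1..k. card (?A i))"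
  proof (rule card_UN_disjoint)
    show "\<forall>i\<in>{1..k}. finite (?A i)" using finite_E by auto
    show "\<forall>i\<in>{1..k}. \<forall>j\<in>{1..k}. i \<noteq> j \<longrightarrow> ?A i \<inter> ?A j = {}"
    proof (intro ballI impI equals0I)
      fix i j e assume ij: "i \<in> {1..k}" "j \<in> {1..k}" "i \<noteq> j" and e: "e \<in> ?A i \<inter> ?A j"
      obtain F where F: "F \<in> K" "e \<in> face_edges E F" "r i \<in> face_verts V F" using e by blast
      obtain F' where F': "F' \<in> K" "e \<in> face_edges E F'" "r j \<in> face_verts V F'" using e by blast
      have "F = F'" using colour_class_edges_disjoint K F F' by blast
      then show False using index_of_face[of F] F F' KF ij by blast
    qed
  qed simp
  moreover have "(\<Union>i\<in>{1..k}. ?A i) = {e \<in> E. Q e}"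
  proof (intro equalityI subsetI)
    fix e assume e: "e \<in> {e \<in> E. Q e}"
    then obtain F where F: "F \<in> K" "e \<in> face_edges E F" using face_of_colour_at_edge[OF K] by blast
    then obtain i where "i \<in> {1..k}" "r i \<in> face_verts V F" using index_of_face KF by blast
    then show "e \<in> (\<Union>i\<in>{1..k}. ?A i)" using e F by blast
  qed blast
  ultimately show ?thesis by simp
qed

text \<open>Disjoint classes could still coincide by being empty; the corners of a face exclude
  this.\<close>

lemma C_neq_S: "R \<noteq> {} \<Longrightarrow> C \<noteq> S"
proof -
  assume "R \<noteq> {}"
  then obtain v where "v \<in> V" using vertex_classes(1) by blast
  then obtain F where "F \<in> faces" by (rule face_at_vertex)
  then obtain c where "c \<in> C" using face_vertex_of_class[of F C] by blast
  then show "C \<noteq> S" using vertex_classes(4) by blast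
qed

text \<open>The bracketings here and in \<open>t_count_eq'\<close> fit
  \<open>sum_card_by_index\<close> for summation over the black index \<open>i\<close> and the white
  index \<open>j\<close> respectively.\<close>

lemma t_count_eq: "n i j = card {e \<in> E.
    (joins C S e \<and> (\<exists>F\<in>Wh. e \<in> face_edges E F \<and> r j \<in> face_verts V F)) \<and>
    (\<exists>F\<in>Bl. e \<in> face_edges E F \<and> r i \<in> face_verts V F)}"
  by (simp only: t_count_def joins_def conj_assoc)

lemma t_count_eq': "n i j = card {e \<in> E.
    (joins C S e \<and> (\<exists>F\<in>Bl. e \<in> face_edges E F \<and> r i \<in> face_verts V F)) \<and>
    (\<exists>F\<in>Wh. e \<in> face_edges E F \<and> r j \<in> face_verts V F)}"
  unfolding t_count_eq by (rule arg_cong[where f = card]) blast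

text \<open>The left sum counts the white triangles at \<open>r v\<close> through their C-S edges,
  the right sum the black ones. The diagonal count \<open>n v v\<close>, which gives no arc of the
  digraph, occurs on both sides and cancels later.\<close>

lemma t_count_balanced:
  assumes "v \<in> {1..k}"
  shows "(\<Sum>i=1..k. n i v) = (\<Sum>j=1..k. n v j)"
proof -
  have R: "r v \<in> R" using r_in_R assms .
  then have CS: "C \<noteq> S" using C_neq_S by blast
  have "(\<Sum>i=1..k. n i v)
    = card {e \<in> E. joins C S e \<and> (\<exists>F\<in>Wh. e \<in> face_edges E F \<and> r v \<in> face_verts V F)}"
    unfolding t_count_eq by (rule sum_card_by_index) simp
  also have "\<dots> = card {F \<in> Wh. r v \<in> face_verts V F}"
    by (rule card_edges_joining_at_vertex) (use CS in auto)
  also have "\<dots> = card {F \<in> Bl. r v \<in> face_verts V F}"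
    using card_faces_at_R_vertex[OF _ R, of Wh] card_faces_at_R_vertex[OF _ R, of Bl] by simp
  also have "\<dots> = card {e \<in> E. joins C S e \<and> (\<exists>F\<in>Bl. e \<in> face_edges E F \<and> r v \<in> face_verts V F)}"
    by (rule card_edges_joining_at_vertex[symmetric]) (use CS in auto)
  also have "\<dots> = (\<Sum>j=1..k. n v j)"
    unfolding t_count_eq' by (rule sum_card_by_index[symmetric]) simp
  finally show ?thesis .
qed

lemma t_count_posI:
  assumes "e \<in> E" "joins C S e" "F \<in> Wh" "e \<in> face_edges E F" "r j \<in> face_verts V F"
    and "F' \<in> Bl" "e \<in> face_edges E F'" "r i \<in> face_verts V F'"
  shows "0 < n i j"
proof -
  have "e \<in> {e \<in> E. (joins C S e \<and> (\<exists>F\<in>Wh. e \<in> face_edges E F \<and> r j \<in> face_verts V F)) \<and>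
    (\<exists>F\<in>Bl. e \<in> face_edges E F \<and> r i \<in> face_verts V F)}"
    using assms by blast
  then show ?thesis unfolding t_count_eq using finite_E by (subst card_gt_0_iff) auto
qed

lemma edge_endpoint_cases:
  assumes "e \<in> E"
  shows "joins C S e \<or> (\<exists>v\<in>R. v \<in> e)"
proof (rule ccontr)
  assume contra: "\<not> (joins C S e \<or> (\<exists>v\<in>R. v \<in> e))"
  then have "e \<inter> R = {}" "e \<inter> C = {} \<or> e \<inter> S = {}" by (auto simp: joins_def)
  then have "e \<inter> V \<subseteq> C \<or> e \<inter> V \<subseteq> S" using vertex_classes(1) by blast
  then show False using edge_not_within_class[OF assms] by blast
qed

text \<open>
  Otherwise the closed triangles with index in \<open>A\<close> and those with index outside \<open>A\<close> meet in vertices only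
  and so separate the connected set \<open>S2 - V\<close>.
\<close>

lemma t_count_cut:
  assumes A: "A \<subseteq> {1..k}" "A \<noteq> {}" "A \<noteq> {1..k}"
  shows "\<exists>i\<in>A. \<exists>j\<in>{1..k} - A. 0 < n i j \<or> 0 < n j i"
proof (rule ccontr)
  assume contra: "\<not> (\<exists>i\<in>A. \<exists>j\<in>{1..k} - A. 0 < n i j \<or> 0 < n j i)"
  define FA where "FA I = {F \<in> faces. \<exists>i\<in>I. r i \<in> face_verts V F}" for I
  define P where "P I = (\<Union>F\<in>FA I. closure F)" for I
  let ?A' = "{1..k} - A"
  have closedP: "closed (P I)" for I
    unfolding P_def FA_def using finite_faces by (intro closed_UN) auto
  have cover: "S2 - V \<subseteq> P A \<union> P ?A'"
  proof
    fix x assume x: "x \<in> S2 - V"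
    then have "x \<in> closure S2" by auto
    then obtain F where F: "F \<in> faces" "x \<in> closure F"
      by (rule face_near_point[OF openin_subtopology_self])
    then obtain i where "i \<in> {1..k}" "r i \<in> face_verts V F" using index_of_face by blast
    then have "F \<in> FA A \<or> F \<in> FA ?A'" using F(1) unfolding FA_def by blast
    then show "x \<in> P A \<union> P ?A'" unfolding P_def using F(2) by blast
  qed
  have no_common: False if FF': "F \<in> FA A" "F' \<in> FA ?A'" "x \<in> closure F" "x \<in> closure F'" "x \<notin> V" for F F' x
  proof -
    obtain i where i: "F \<in> faces" "i \<in> A" "r i \<in> face_verts V F" using FF'(1) unfolding FA_def by blast
    obtain j where j: "F' \<in> faces" "j \<in> ?A'" "r j \<in> face_verts V F'" using FF'(2) unfolding FA_def by blast
    have ik: "i \<in> {1..k}" "j \<in> {1..k}" "i \<noteq> j" using i j A by auto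
    have ne: "F \<noteq> F'" using index_of_face[OF i(1)] i j ik by metis
    have no_inner: "x \<notin> G" if G: "G \<in> faces" "G' \<in> faces" "G \<noteq> G'" "x \<in> closure G'" for G G'
    proof
      assume x: "x \<in> G"
      obtain T where T: "open T" "G = S2 \<inter> T" using openin_face[OF G(1)] by (metis openin_open)
      then have "G' \<inter> T \<noteq> {}"
        using G(4) x by (metis IntD2 closure_iff_nhds_not_empty order_refl)
      then have "G' \<inter> G \<noteq> {}" using T(2) face_sub[OF G(2)] by blast
      then show False using faces_disjoint[OF G(1,2,3)] by blast
    qed
    have "x \<notin> F" using no_inner i(1) j(1) ne FF'(4) by blast
    then have "x \<in> face_boundary F" using FF'(3) face_boundary_eq[OF i(1)] by blast
    moreover obtain e1 e2 e3 u v w where "e1 \<in> E" "e2 \<in> E" "e3 \<in> E" "face_boundary F = e1 \<union> e2 \<union> e3"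
      by (rule face_triangle[OF i(1)]) blast
    ultimately obtain e where e: "e \<in> E" "x \<in> e" by blast
    have eF: "e \<in> face_edges E F" "e \<in> face_edges E F'"
      using face_edgeI e FF' i(1) j(1) by blast+
    have colours: "(F \<in> Wh \<and> F' \<in> Bl) \<or> (F' \<in> Wh \<and> F \<in> Bl)"
    proof -
      have "F \<in> Wh \<union> Bl" "F' \<in> Wh \<union> Bl" using i(1) j(1) Wh_Bl by simp_all
      then show ?thesis
        using ne eF colour_class_edges_disjoint[of Wh F F' e] colour_class_edges_disjoint[of Bl F F' e] by auto
    qed
    \<comment> \<open>A C-S edge between the two faces makes one of the two counts positive. An edge
      with an end in \<open>R\<close> gives both faces the same corner in \<open>R\<close>, hence
      the same index.\<close>
    from edge_endpoint_cases[OF e(1)] show False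
    proof
      assume "joins C S e"
      then have "0 < n j i \<or> 0 < n i j"
        using colours t_count_posI[OF e(1), of F i F' j] t_count_posI[OF e(1), of F' j F i] eF i(3) j(3)
        by metis
      then show False using contra i(2) j(2) by blast
    next
      assume "\<exists>v\<in>R. v \<in> e"
      then obtain v where v: "v \<in> R" "v \<in> e" by blast
      then have fv: "v \<in> face_verts V F" "v \<in> face_verts V F'"
        using eF class_sub_V[of R] unfolding face_verts_def face_edges_def by blast+
      obtain l where "l \<in> {1..k}" "v = r l" using R_vertex_index[OF v(1)] by blast
      then show False using index_of_face[OF i(1)] index_of_face[OF j(1)] fv i(3) j(3) ik by metis
    qed
  qed
  have nonempty: "P I \<inter> (S2 - V) \<noteq> {}" if I: "I \<subseteq> {1..k}" "I \<noteq> {}" for I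
  proof -
    obtain i where i: "i \<in> I" using I(2) by blast
    then have "r i \<in> V" using r_in_R I(1) class_sub_V[of R] by blast
    then obtain F where F: "F \<in> faces" "r i \<in> face_verts V F" by (rule face_at_vertex)
    then have "F \<subseteq> P I" using i closure_subset unfolding P_def FA_def by blast
    then show ?thesis using face_nonempty[OF F(1)] face_sub[OF F(1)] by blast
  qed
  have "V \<noteq> {}" using A r_in_R class_sub_V[of R] by blast
  then have con: "connected (S2 - V)" by (rule connected_S2_Diff_V)
  have "P A \<inter> P ?A' \<inter> (S2 - V) = {}"
    unfolding P_def using no_common by blast
  then have "P A \<inter> (S2 - V) = {} \<or> P ?A' \<inter> (S2 - V) = {}"
    using connected_closedD[OF con _ cover closedP closedP] by blast
  moreover have "?A' \<noteq> {}" using A by blast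
  ultimately show False using nonempty[of A] nonempty[of ?A'] A by blast
qed

end

section \<open>The index of a lattice of integer vectors\<close>

definition row_det :: "nat \<Rightarrow> (nat \<Rightarrow> nat \<Rightarrow> int) \<Rightarrow> int"
  where "row_det m M = Determinant.det (Matrix.mat m m (\<lambda>(i, j). M i j))"

text \<open>Coordinates from \<open>m\<close> on are unconstrained, so the functions modulo this set
  form Z^m modulo the rows of \<open>M\<close>.\<close>

definition row_lattice :: "nat \<Rightarrow> (nat \<Rightarrow> nat \<Rightarrow> int) \<Rightarrow> (nat \<Rightarrow> int) set"
  where "row_lattice m M = {v. \<exists>c. \<forall>j<m. v j = (\<Sum>i<m. c i * M i j)}"

lemma row_lattice_diff:
  assumes "u \<in> row_lattice m M" "v \<in> row_lattice m M"
  shows "(\<lambda>j. u j - v j) \<in> row_lattice m M"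
proof -
  obtain c d where "\<forall>j<m. u j = (\<Sum>i<m. c i * M i j)" "\<forall>j<m. v j = (\<Sum>i<m. d i * M i j)"
    using assms by (auto simp: row_lattice_def)
  then have "\<forall>j<m. u j - v j = (\<Sum>i<m. (c i - d i) * M i j)"
    by (simp add: sum_subtractf left_diff_distrib)
  then show ?thesis unfolding row_lattice_def by (intro CollectI exI)
qed

lemma zero_in_row_lattice: "(\<lambda>j. 0) \<in> row_lattice m M"
  unfolding row_lattice_def by (intro CollectI exI[of _ "\<lambda>i. 0"]) simp

definition add_row :: "int \<Rightarrow> nat \<Rightarrow> nat \<Rightarrow> (nat \<Rightarrow> nat \<Rightarrow> int) \<Rightarrow> nat \<Rightarrow> nat \<Rightarrow> int"
  where "add_row a k l M = M(k := (\<lambda>j. M k j + a * M l j))"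

lemma row_det_add_row:
  assumes "k < m" "l < m" "k \<noteq> l"
  shows "row_det m (add_row a k l M) = row_det m M"
proof -
  have "Matrix.mat m m (\<lambda>(i, j). add_row a k l M i j) = addrow a k l (Matrix.mat m m (\<lambda>(i, j). M i j))"
    using assms by (auto simp: mat_addrow_def add_row_def intro!: eq_matI)
  then show ?thesis
    unfolding row_det_def using det_addrow[of l m k "Matrix.mat m m (\<lambda>(i, j). M i j)" a] assms by simp
qed

lemma row_lattice_add_row_sub:
  assumes "k < m" "l < m" "k \<noteq> l"
  shows "row_lattice m (add_row a k l M) \<subseteq> row_lattice m M"
proof
  fix v assume "v \<in> row_lattice m (add_row a k l M)"
  then obtain c where c: "\<forall>j<m. v j = (\<Sum>i<m. c i * add_row a k l M i j)"
    by (auto simp: row_lattice_def)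
  \<comment> \<open>The multiple of row \<open>l\<close> contained in the new row \<open>k\<close>
    is credited to row \<open>l\<close>.\<close>
  define d where "d = c(l := c l + a * c k)"
  have "(\<Sum>i<m. c i * add_row a k l M i j) = (\<Sum>i<m. d i * M i j)" for j
  proof -
    have "(\<Sum>i<m. c i * add_row a k l M i j) = (\<Sum>i<m. c i * M i j + (if i = k then a * c k * M l j else 0))"
      by (rule sum.cong) (auto simp: add_row_def algebra_simps)
    also have "\<dots> = (\<Sum>i<m. c i * M i j) + a * c k * M l j"
      using assms by (simp add: sum.distrib)
    also have "\<dots> = (\<Sum>i<m. c i * M i j + (if i = l then a * c k * M l j else 0))"
      using assms by (simp add: sum.distrib)
    also have "\<dots> = (\<Sum>i<m. d i * M i j)"
      by (rule sum.cong) (auto simp: d_def algebra_simps)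
    finally show ?thesis .
  qed
  then show "v \<in> row_lattice m M" using c by (auto simp: row_lattice_def)
qed

lemma row_lattice_add_row:
  assumes "k < m" "l < m" "k \<noteq> l"
  shows "row_lattice m (add_row a k l M) = row_lattice m M"
proof
  have "add_row (- a) k l (add_row a k l M) = M"
    using assms by (auto simp: add_row_def fun_eq_iff)
  then show "row_lattice m M \<subseteq> row_lattice m (add_row a k l M)"
    using row_lattice_add_row_sub[OF assms, of "- a" "add_row a k l M"] by simp
qed (rule row_lattice_add_row_sub[OF assms])

text \<open>The Euclidean algorithm on the first column.\<close>

lemma clear_first_column:
  "\<exists>M'. (\<forall>i<m. 0 < i \<longrightarrow> M' i 0 = 0) \<and> row_det m M' = row_det m M \<and> row_lattice m M' = row_lattice m M"
proof (induction "\<Sum>i<m. nat \<bar>M i 0\<bar>" arbitrary: M rule: less_induct)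
  case less
  show ?case
  proof (cases "\<exists>k<m. \<exists>l<m. k \<noteq> l \<and> M l 0 \<noteq> 0 \<and> \<bar>M l 0\<bar> \<le> \<bar>M k 0\<bar>")
    case True
    then obtain k l where kl: "k < m" "l < m" "k \<noteq> l" "M l 0 \<noteq> 0" "\<bar>M l 0\<bar> \<le> \<bar>M k 0\<bar>" by blast
    \<comment> \<open>Adding or subtracting row \<open>l\<close> once lowers the absolute value of
      the entry in row \<open>k\<close> by that of the entry in row \<open>l\<close>.\<close>
    define a where "a = - sgn (M k 0) * sgn (M l 0)"
    define M' where "M' = add_row a k l M"
    have "\<bar>M' k 0\<bar> < \<bar>M k 0\<bar>"
      using kl by (auto simp: M'_def add_row_def a_def sgn_if)
    moreover have "M' i = M i" if "i \<noteq> k" for i using that by (simp add: M'_def add_row_def)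
    ultimately have "(\<Sum>i<m. nat \<bar>M' i 0\<bar>) < (\<Sum>i<m. nat \<bar>M i 0\<bar>)"
      using kl by (intro sum_strict_mono_ex1) (auto intro!: bexI[of _ k], metis order_refl nat_le_eq_zle order_less_imp_le abs_ge_zero)
    from less[of M', OF this] obtain M'' where "\<forall>i<m. 0 < i \<longrightarrow> M'' i 0 = 0"
      "row_det m M'' = row_det m M'" "row_lattice m M'' = row_lattice m M'" by blast
    then show ?thesis
      unfolding M'_def row_det_add_row[OF kl(1-3)] row_lattice_add_row[OF kl(1-3)] by blast
  next
    case False
    show ?thesis
    proof (cases "\<exists>p<m. 0 < p \<and> M p 0 \<noteq> 0")
      case True
      then obtain p where p: "p < m" "0 < p" "M p 0 \<noteq> 0" by blast
      have zero: "M i 0 = 0" if "i < m" "i \<noteq> p" for i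
      proof (rule ccontr)
        assume i: "M i 0 \<noteq> 0"
        have "\<bar>M i 0\<bar> \<le> \<bar>M p 0\<bar> \<or> \<bar>M p 0\<bar> \<le> \<bar>M i 0\<bar>" by linarith
        then show False using False i p that by metis
      qed
      \<comment> \<open>Only row \<open>p\<close> still has an entry in column 0, since two such
        rows would allow another reduction. Two row additions move it to row 0; a swap would change
        the sign of the determinant.\<close>
      define M' where "M' = add_row (- 1) p 0 (add_row 1 0 p M)"
      have "\<forall>i<m. 0 < i \<longrightarrow> M' i 0 = 0"
        using p zero by (auto simp: M'_def add_row_def)
      moreover have "row_det m M' = row_det m M" "row_lattice m M' = row_lattice m M"
        unfolding M'_def using p by (simp_all add: row_det_add_row row_lattice_add_row)
      ultimately show ?thesis by blast
    next
      case False
      then show ?thesis by (intro exI[of _ M]) auto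
    qed
  qed
qed

lemma row_det_Suc:
  assumes "\<forall>i<m. M (Suc i) 0 = 0"
  shows "row_det (Suc m) M = M 0 0 * row_det m (\<lambda>i j. M (Suc i) (Suc j))"
proof -
  let ?A = "Matrix.mat (Suc m) (Suc m) (\<lambda>(i, j). M i j)"
  have "row_det (Suc m) M = (\<Sum>i<Suc m. ?A $$ (i, 0) * cofactor ?A i 0)"
    unfolding row_det_def by (rule laplace_expansion_column) auto
  also have "\<dots> = ?A $$ (0, 0) * cofactor ?A 0 0"
    unfolding sum.lessThan_Suc_shift using assms by simp
  also have "mat_delete ?A 0 0 = Matrix.mat m m (\<lambda>(i, j). M (Suc i) (Suc j))"
    by (auto simp: mat_delete_def intro!: eq_matI)
  then have "cofactor ?A 0 0 = row_det m (\<lambda>i j. M (Suc i) (Suc j))"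
    by (simp add: cofactor_def row_det_def)
  finally show ?thesis by simp
qed

text \<open>Row 0 alone meets column 0, so coordinate 0 constrains only its multiple
  \<open>q\<close>.\<close>

lemma row_lattice_Suc:
  assumes "\<forall>i<m. M (Suc i) 0 = 0"
  shows "v \<in> row_lattice (Suc m) M \<longleftrightarrow> (\<exists>q. v 0 = q * M 0 0 \<and>
    (\<lambda>j. v (Suc j) - q * M 0 (Suc j)) \<in> row_lattice m (\<lambda>i j. M (Suc i) (Suc j)))"
proof
  assume "v \<in> row_lattice (Suc m) M"
  then obtain c where c: "\<forall>j<Suc m. v j = (\<Sum>i<Suc m. c i * M i j)" by (auto simp: row_lattice_def)
  have c0: "v 0 = c 0 * M 0 0" using c assms by (simp add: sum.lessThan_Suc_shift del: sum.lessThan_Suc)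
  have "\<forall>j<m. v (Suc j) - c 0 * M 0 (Suc j) = (\<Sum>i<m. c (Suc i) * M (Suc i) (Suc j))"
    using c by (simp add: sum.lessThan_Suc_shift del: sum.lessThan_Suc)
  then show "\<exists>q. v 0 = q * M 0 0 \<and>
    (\<lambda>j. v (Suc j) - q * M 0 (Suc j)) \<in> row_lattice m (\<lambda>i j. M (Suc i) (Suc j))"
    using c0 unfolding row_lattice_def by (intro exI[of _ "c 0"] conjI CollectI exI[of _ "\<lambda>i. c (Suc i)"])
next
  assume "\<exists>q. v 0 = q * M 0 0 \<and>
    (\<lambda>j. v (Suc j) - q * M 0 (Suc j)) \<in> row_lattice m (\<lambda>i j. M (Suc i) (Suc j))"
  then obtain q c where q: "v 0 = q * M 0 0"
    and c: "\<forall>j<m. v (Suc j) - q * M 0 (Suc j) = (\<Sum>i<m. c i * M (Suc i) (Suc j))"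
    by (auto simp: row_lattice_def)
  have "v j = (\<Sum>i<Suc m. (case i of 0 \<Rightarrow> q | Suc i \<Rightarrow> c i) * M i j)" if "j < Suc m" for j
    using that q c assms by (cases j) (auto simp: sum.lessThan_Suc_shift algebra_simps simp del: sum.lessThan_Suc)
  then show "v \<in> row_lattice (Suc m) M" unfolding row_lattice_def by blast
qed

text \<open>Once column 0 is cleared below its top entry \<open>a\<close>, a vector is reduced by a
  remainder modulo the absolute value of \<open>a\<close> in coordinate 0, followed by a
  representative for the smaller lattice. The index is expressed by a transversal \<open>X\<close>,
  which is later carried over to cosets.\<close>

lemma row_lattice_representatives:
  assumes "row_det m M \<noteq> 0"
  shows "\<exists>X. finite X \<and> int (card X) = \<bar>row_det m M\<bar> \<and>
    (\<forall>v. \<exists>!x. x \<in> X \<and> (\<lambda>j. v j - x j) \<in> row_lattice m M)"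
  using assms
proof (induction m arbitrary: M)
  case 0
  have "row_det 0 M = 1" by (simp add: row_det_def)
  moreover have "\<exists>!x. x \<in> {\<lambda>_. 0} \<and> (\<lambda>j. v j - x j) \<in> row_lattice 0 M" for v
    by (simp add: row_lattice_def)
  ultimately show ?case by (intro exI[of _ "{\<lambda>_. 0}"]) simp
next
  case (Suc m)
  obtain M' where M': "\<forall>i<Suc m. 0 < i \<longrightarrow> M' i 0 = 0" "row_det (Suc m) M' = row_det (Suc m) M"
    "row_lattice (Suc m) M' = row_lattice (Suc m) M"
    using clear_first_column[of "Suc m" M] by blast
  have col: "\<forall>i<m. M' (Suc i) 0 = 0" using M'(1) by simp
  define N where "N = (\<lambda>i j. M' (Suc i) (Suc j))"
  define a where "a = M' 0 0"
  note rdet = row_det_Suc[of m M', OF col, folded N_def a_def]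
  note rlat = row_lattice_Suc[of m M', OF col, folded N_def a_def]
  have "row_det m N \<noteq> 0" and a: "a \<noteq> 0" using Suc.prems M'(2) rdet by auto
  then obtain X where X: "finite X" "int (card X) = \<bar>row_det m N\<bar>"
    "\<And>v. \<exists>!x. x \<in> X \<and> (\<lambda>j. v j - x j) \<in> row_lattice m N"
    using Suc.IH by metis
  define f :: "int \<times> (nat \<Rightarrow> int) \<Rightarrow> nat \<Rightarrow> int" where "f = (\<lambda>(r, x) j. case j of 0 \<Rightarrow> r | Suc j \<Rightarrow> x j)"
  have f: "f (r, x) 0 = r" "f (r, x) (Suc j) = x j" for r x j by (simp_all add: f_def)
  have inj: "inj f"
  proof (rule injI)
    fix p q assume "f p = f q"
    then have "f p 0 = f q 0" "\<And>j. f p (Suc j) = f q (Suc j)" by auto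
    then show "p = q" by (cases p; cases q) (simp add: f fun_eq_iff)
  qed
  define Y where "Y = f ` ({0..<\<bar>a\<bar>} \<times> X)"
  have "int (card Y) = \<bar>a\<bar> * int (card X)"
    unfolding Y_def using card_image[OF inj_on_subset[OF inj]] by (simp add: card_cartesian_product)
  then have "int (card Y) = \<bar>row_det (Suc m) M\<bar>" using X(2) M'(2) rdet by (simp add: abs_mult)
  moreover have "finite Y" using X(1) by (simp add: Y_def)
  moreover have "\<exists>!y. y \<in> Y \<and> (\<lambda>j. v j - y j) \<in> row_lattice (Suc m) M" for v
  proof (rule ex_ex1I)
    define r where "r = v 0 mod \<bar>a\<bar>"
    obtain q where q: "v 0 - r = q * a"
    proof -
      have "a dvd v 0 - r" unfolding r_def by (metis abs_dvd_iff mod_eq_dvd_iff mod_mod_trivial)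
      then show thesis using that by (metis dvd_def mult.commute)
    qed
    obtain x where x: "x \<in> X" "(\<lambda>j. (v (Suc j) - q * M' 0 (Suc j)) - x j) \<in> row_lattice m N"
      using X(3)[of "\<lambda>j. v (Suc j) - q * M' 0 (Suc j)"] by blast
    have "f (r, x) \<in> Y" using x(1) a by (simp add: Y_def r_def)
    moreover have "(\<lambda>j. v j - f (r, x) j) \<in> row_lattice (Suc m) M"
      unfolding M'(3)[symmetric] rlat using q x(2)
      by (intro exI[of _ q]) (simp add: f algebra_simps)
    ultimately show "\<exists>y. y \<in> Y \<and> (\<lambda>j. v j - y j) \<in> row_lattice (Suc m) M" by blast
  next
    fix y z
    assume y: "y \<in> Y \<and> (\<lambda>j. v j - y j) \<in> row_lattice (Suc m) M"
      and z: "z \<in> Y \<and> (\<lambda>j. v j - z j) \<in> row_lattice (Suc m) M"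
    obtain r x where rx: "y = f (r, x)" "0 \<le> r" "r < \<bar>a\<bar>" "x \<in> X" using y by (auto simp: Y_def)
    obtain s w where sw: "z = f (s, w)" "0 \<le> s" "s < \<bar>a\<bar>" "w \<in> X" using z by (auto simp: Y_def)
    have "(\<lambda>j. (v j - z j) - (v j - y j)) \<in> row_lattice (Suc m) M"
      using y z row_lattice_diff by blast
    then obtain q where q: "r - s = q * a" "(\<lambda>j. x j - w j - q * M' 0 (Suc j)) \<in> row_lattice m N"
      unfolding M'(3)[symmetric] rlat by (auto simp: rx(1) sw(1) f)
    have "\<bar>r - s\<bar> < \<bar>a\<bar>" using rx sw by linarith
    then have "a dvd r - s" "\<bar>r - s\<bar> < \<bar>a\<bar>" using q(1) by auto
    then have "r - s = 0" using zdvd_not_zless dvd_imp_le_int by (meson abs_le_iff linorder_not_le)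
    then have "q = 0" using q(1) a by simp
    then have "r = s" "(\<lambda>j. x j - w j) \<in> row_lattice m N" using q by auto
    then have "x = w" using X(3)[of x] rx(4) sw(4) zero_in_row_lattice[of m N] by auto
    then show "y = z" using \<open>r = s\<close> rx sw by simp
  qed
  ultimately show ?case by blast
qed

section \<open>Spanning arborescences\<close>

lemma both_ways_simps [simp]:
  "verts (both_ways G) = verts G" "arcs (both_ways G) = arcs G \<times> UNIV"
  "tail (both_ways G) (a, True) = tail G a" "tail (both_ways G) (a, False) = head G a"
  "head (both_ways G) (a, True) = head G a" "head (both_ways G) (a, False) = tail G a"
  by (simp_all add: both_ways_def)

context wf_digraph
begin

lemma wf_both_ways: "wf_digraph (both_ways G)"
  by unfold_locales (auto simp: both_ways_def split: prod.splits)

text \<open>Connectedness is defined through \<open>mk_symmetric\<close>, paths and cycles of a tree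
  through \<open>both_ways\<close>; reachability depends only on the end pairs, which agree.\<close>

lemma arcs_ends_mk_symmetric: "arcs_ends (with_proj (mk_symmetric G)) = arcs_ends (both_ways G)"
proof -
  have "arcs_ends (with_proj (mk_symmetric G)) = parcs (mk_symmetric G)"
    by (auto simp: arcs_ends_def arc_to_ends_def)
  also have "\<dots> = arcs_ends (both_ways G)"
  proof -
    have "arcs_ends (both_ways G)
      = (\<Union>a\<in>arcs G. (\<lambda>b. (tail (both_ways G) (a, b), head (both_ways G) (a, b))) ` UNIV)"
      by (auto simp: arcs_ends_conv)
    then show ?thesis by (auto simp: parcs_mk_symmetric UNIV_bool)
  qed
  finally show ?thesis .
qed

lemma forward_walk:
  assumes "pre_digraph.awalk (both_ways G) u p v" "\<forall>s\<in>set p. snd s"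
  shows "awalk u (map fst p) v"
proof -
  interpret B: wf_digraph "both_ways G" by (rule wf_both_ways)
  show ?thesis using assms
  proof (induction p arbitrary: u)
    case Nil
    then show ?case by (auto simp: B.awalk_Nil_iff awalk_Nil_iff)
  next
    case (Cons s p)
    then obtain a where "s = (a, True)" by (cases s) auto
    then show ?case using Cons by (auto simp: B.awalk_Cons_iff awalk_Cons_iff)
  qed
qed

lemma loop_not_undirected_tree:
  assumes "undirected_tree G" "a \<in> arcs G"
  shows "tail G a \<noteq> head G a"
proof
  interpret B: wf_digraph "both_ways G" by (rule wf_both_ways)
  assume "tail G a = head G a"
  then have "B.awalk (tail G a) [(a, True)] (tail G a)"
    using assms(2) by (simp add: B.awalk_simps)
  then have "B.cycle [(a, True)]" unfolding B.cycle_def by (intro exI conjI) auto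
  moreover have "distinct (map fst [(a, True)])" by simp
  ultimately show False using assms(1) unfolding undirected_tree_def by blast
qed

lemma arborescence_forward_path:
  assumes arb: "arborescence_from z G" and v: "v \<in> verts G"
  obtains q where "pre_digraph.apath (both_ways G) z q v" "\<forall>s\<in>set q. snd s"
proof -
  interpret B: wf_digraph "both_ways G" by (rule wf_both_ways)
  have "z \<rightarrow>\<^sup>*\<^bsub>with_proj (mk_symmetric G)\<^esub> v"
    using arb v by (auto simp: arborescence_from_def undirected_tree_def Digraph_Component.connected_def)
  then have "z \<rightarrow>\<^sup>*\<^bsub>both_ways G\<^esub> v"
    unfolding reachable_def arcs_ends_mk_symmetric by simp
  then obtain q where "B.apath z q v" using B.reachable_apath by blast
  then show thesis using that arb unfolding arborescence_from_def by blast
qed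

text \<open>Traversed backwards, such an arc would be a path from \<open>z\<close> against its
  direction.\<close>

lemma arborescence_no_arc_to_root:
  assumes arb: "arborescence_from z G" and a: "a \<in> arcs G"
  shows "head G a \<noteq> z"
proof
  interpret B: wf_digraph "both_ways G" by (rule wf_both_ways)
  assume z: "head G a = z"
  have "tail G a \<noteq> head G a"
    using arb a loop_not_undirected_tree unfolding arborescence_from_def by blast
  then have "B.apath z [(a, False)] (tail G a)"
    using a z by (simp add: B.apath_simps)
  then show False using arb unfolding arborescence_from_def by (metis list.set_intros(1) snd_conv)
qed

text \<open>Follow a forward path \<open>q\<close> from \<open>z\<close> to the common head and then
  leave along another incoming arc \<open>x\<close> backwards. If the tail of \<open>x\<close> is
  new, this is a path from \<open>z\<close> with a backward step; otherwise \<open>x\<close> closes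
  a cycle with the end of \<open>q\<close>.\<close>

lemma arborescence_unique_in_arc:
  assumes arb: "arborescence_from z G" and ab: "a \<in> arcs G" "b \<in> arcs G" "head G a = head G b"
  shows "a = b"
proof (rule ccontr)
  interpret B: wf_digraph "both_ways G" by (rule wf_both_ways)
  assume "a \<noteq> b"
  define v where "v = head G a"
  have vz: "v \<noteq> z" using arborescence_no_arc_to_root[OF arb ab(1)] by (simp add: v_def)
  have "v \<in> verts G" using ab(1) by (simp add: v_def)
  then obtain q where q: "B.apath z q v" "\<forall>s\<in>set q. snd s"
    by (rule arborescence_forward_path[OF arb])
  \<comment> \<open>At least one of \<open>a\<close> and \<open>b\<close> is not the last arc of
    \<open>q\<close>.\<close>
  obtain x where x: "x \<in> arcs G" "head G x = v" "last q \<noteq> (x, True)"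
    using ab \<open>a \<noteq> b\<close> unfolding v_def by (metis prod.inject)
  define u where "u = tail G x"
  have uv: "u \<noteq> v"
    using loop_not_undirected_tree[OF _ x(1)] arb x(2) unfolding u_def arborescence_from_def by metis
  have bk: "B.apath v [(x, False)] u"
    using x uv by (simp add: B.apath_simps u_def)
  have awq: "B.awalk z q v" using q(1) by (rule B.awalkI_apath)
  show False
  proof (cases "u \<in> set (B.awalk_verts z q)")
    case False
    then have "B.apath z (q @ [(x, False)]) u"
      using q(1) bk awq unfolding B.apath_append_iff by (simp add: u_def)
    then show False using arb unfolding arborescence_from_def by (metis in_set_conv_decomp snd_conv)
  next
    case True
    obtain r s where rs: "q = r @ s" "B.awalk z r u" "B.awalk u s v"
      using B.awalk_decomp[OF awq True] by blast
    have s: "B.apath u s v"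
      using q(1) rs(2) unfolding rs(1) B.apath_append_iff by simp
    have s_ne: "s \<noteq> []" using rs(3) uv by (auto simp: B.awalk_Nil_iff)
    have fwd: "\<forall>e\<in>set s. snd e" using q(2) rs(1) by simp
    have verts_s: "B.awalk_verts u s = u # map (head (both_ways G)) s"
      using B.awalk_verts_conv'[of u s v] rs(3) s_ne by (cases s) (auto simp: B.awalk_def)
    then have dist: "distinct (u # map (head (both_ways G)) s)" using s by (simp add: B.apath_def)
    have inj: "inj_on fst (set s)" using fwd by (auto simp: inj_on_def)
    have "B.awlast u s = v" using rs(3) B.awlast_if_cas by (simp add: B.awalk_def)
    then have last_s: "last s \<in> set s" "head (both_ways G) (last s) = v"
      using s_ne unfolding verts_s by (simp_all add: last_map)
    \<comment> \<open>\<open>s\<close> visits \<open>v\<close> only at its end, so an arc of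
      \<open>s\<close> into \<open>v\<close> would be the last arc of \<open>q\<close>, which
      \<open>x\<close> is not.\<close>
    have "(x, True) \<notin> set s"
    proof
      assume "(x, True) \<in> set s"
      moreover have "inj_on (head (both_ways G)) (set s)" using dist by (simp add: distinct_map)
      ultimately have "(x, True) = last s"
        using last_s x(2) by (metis both_ways_simps(5) inj_onD)
      then show False using x(3) rs(1) s_ne by simp
    qed
    then have "x \<notin> fst ` set s" using fwd by auto
    then have "distinct (map fst (s @ [(x, False)]))"
      using dist inj by (auto simp: distinct_map)
    moreover have "B.cycle (s @ [(x, False)])"
      unfolding B.cycle_def
    proof (intro exI conjI)
      have w: "B.awalk u (s @ [(x, False)]) u"
        using rs(3) bk by (auto simp: B.apath_def)
      then show "B.awalk u (s @ [(x, False)]) u" .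
      have "B.awalk_verts u (s @ [(x, False)]) = B.awalk_verts u s @ [u]"
        using B.awalk_verts_append[OF w] rs(3) by (simp add: u_def)
      then show "distinct (tl (B.awalk_verts u (s @ [(x, False)])))"
        using dist verts_s by simp
    qed simp
    ultimately show False using arb unfolding arborescence_from_def undirected_tree_def by blast
  qed
qed

text \<open>After a forward step into a vertex, a backward step would use an arc with that vertex as
  head, hence the same arc again, and \<open>distinct_adj\<close> forbids an immediate
  repetition.\<close>

lemma walk_stays_forward:
  assumes unique: "\<And>a b. a \<in> arcs G \<Longrightarrow> b \<in> arcs G \<Longrightarrow> head G a = head G b \<Longrightarrow> a = b"
    and "pre_digraph.awalk (both_ways G) u p v" "distinct_adj (map fst p)" "p \<noteq> []" "snd (hd p)"
  shows "\<forall>s\<in>set p. snd s"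
  using assms(2-)
proof (induction p arbitrary: u)
  interpret B: wf_digraph "both_ways G" by (rule wf_both_ways)
  case (Cons s p)
  show ?case
  proof (cases p)
    case Nil
    then show ?thesis using Cons.prems by simp
  next
    case (Cons t q)
    obtain a b \<beta> where st: "s = (a, True)" "t = (b, \<beta>)" using Cons.prems(4) by (cases s; cases t) auto
    have w: "a \<in> arcs G" "B.awalk (head G a) p v"
      using Cons.prems(1) st by (auto simp: B.awalk_Cons_iff)
    have "a \<noteq> b" using Cons.prems(2) st Cons by simp
    then have \<beta>
      using w unique[of a b] st(2) Cons by (cases \<beta>) (auto simp: B.awalk_Cons_iff)
    then show ?thesis using Cons.IH[OF w(2)] Cons.prems st Cons by auto
  qed
qed simp

text \<open>A forward step would make all later steps forward, including the last one.\<close>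

lemma walk_stays_backward:
  assumes unique: "\<And>a b. a \<in> arcs G \<Longrightarrow> b \<in> arcs G \<Longrightarrow> head G a = head G b \<Longrightarrow> a = b"
    and "pre_digraph.awalk (both_ways G) u p v" "distinct_adj (map fst p)" "p \<noteq> []" "\<not> snd (last p)"
  shows "\<forall>s\<in>set p. \<not> snd s"
  using assms(2-)
proof (induction p arbitrary: u)
  interpret B: wf_digraph "both_ways G" by (rule wf_both_ways)
  case (Cons s p)
  have "\<not> snd s"
    using walk_stays_forward[OF unique Cons.prems(1-3)] Cons.prems(4) by (metis last_in_set list.sel(1) list.simps(3))
  then show ?case
    using Cons by (cases "p = []") (auto simp: B.awalk_Cons_iff distinct_adj_Cons)
qed simp

text \<open>Using an arc twice in a row would return to the vertex just left.\<close>

lemma apath_distinct_adj: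
  assumes "pre_digraph.apath (both_ways G) u p v"
  shows "distinct_adj (map fst p)"
  using assms
proof (induction p arbitrary: u)
  interpret B: wf_digraph "both_ways G" by (rule wf_both_ways)
  case (Cons s p)
  show ?case
  proof (cases p)
    case (Cons t q)
    have "B.apath (head (both_ways G) t) q v" using Cons.prems Cons by (simp add: B.apath_Cons_iff)
    then have "head (both_ways G) t \<in> set (B.awalk_verts (head (both_ways G) t) q)"
      by (rule B.hd_in_awalk_verts(2))
    then have "fst s \<noteq> fst t"
      using Cons.prems Cons by (cases s; cases t; cases "snd s"; cases "snd t") (auto simp: B.apath_Cons_iff)
    then show ?thesis using Cons.IH Cons.prems Cons by (auto simp: B.apath_Cons_iff)
  qed simp
qed simp

end

context wf_digraph begin
text \<open>The distance \<open>dep\<close> from \<open>z\<close> grows by exactly one along each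
  arc, since a shortest walk to the head must end with the only arc entering it. Hence no closed
  walk runs in one direction throughout.\<close>

lemma arborescenceI:
  assumes z: "z \<in> verts G" and reach: "\<And>v. v \<in> verts G \<Longrightarrow> z \<rightarrow>\<^sup>* v"
    and root: "\<And>a. a \<in> arcs G \<Longrightarrow> head G a \<noteq> z"
    and unique: "\<And>a b. a \<in> arcs G \<Longrightarrow> b \<in> arcs G \<Longrightarrow> head G a = head G b \<Longrightarrow> a = b"
  shows "arborescence_from z G"
proof -
  interpret B: wf_digraph "both_ways G" by (rule wf_both_ways)
  define dep where "dep v = (LEAST m. \<exists>p. awalk z p v \<and> length p = m)" for v
  have dep_walk: "\<exists>p. awalk z p v \<and> length p = dep v" if "v \<in> verts G" for v
  proof -
    have "\<exists>p. awalk z p v" using reach[OF \<open>v \<in> verts G\<close>] by (simp only: reachable_awalk)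
    then have "\<exists>m. \<exists>p. awalk z p v \<and> length p = m" by blast
    then show ?thesis unfolding dep_def by (rule LeastI_ex)
  qed
  have dep_le: "dep v \<le> length p" if "awalk z p v" for v p
    unfolding dep_def by (rule Least_le) (use that in blast)
  have dep_arc: "dep (head G a) = Suc (dep (tail G a))" if a: "a \<in> arcs G" for a
  proof (rule antisym)
    obtain p where p: "awalk z p (tail G a)" "length p = dep (tail G a)"
      using dep_walk[of "tail G a"] a by auto
    then have "awalk z (p @ [a]) (head G a)" using a by (auto simp: awalk_simps)
    then show "dep (head G a) \<le> Suc (dep (tail G a))"
      using dep_le[of "p @ [a]" "head G a"] p(2) by simp
    obtain q where q: "awalk z q (head G a)" "length q = dep (head G a)"
      using dep_walk[of "head G a"] a by auto
    then have "q \<noteq> []" using root[OF a] by (auto simp: awalk_Nil_iff)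
    then obtain q' b where qb: "q = q' @ [b]" by (metis rev_exhaust)
    then have b: "awalk z q' (tail G b)" "b \<in> arcs G" "head G b = head G a"
      using q(1) by (auto simp: awalk_simps)
    then have "b = a" using unique a by blast
    then show "Suc (dep (tail G a)) \<le> dep (head G a)" using dep_le[OF b(1)] q(2) qb by simp
  qed
  have fwd_dep: "dep v = dep u + length p" if "B.awalk u p v" "\<forall>s\<in>set p. snd s" for u p v
    using that
  proof (induction p arbitrary: u)
    case (Cons s p)
    then obtain a where "s = (a, True)" by (cases s) auto
    then show ?case using Cons dep_arc[of a] by (auto simp: B.awalk_Cons_iff)
  qed (simp add: B.awalk_Nil_iff)
  have bwd_dep: "dep u = dep v + length p" if "B.awalk u p v" "\<forall>s\<in>set p. \<not> snd s" for u p v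
    using that
  proof (induction p arbitrary: u)
    case (Cons s p)
    then obtain a where "s = (a, False)" by (cases s) auto
    then show ?case using Cons dep_arc[of a] by (auto simp: B.awalk_Cons_iff)
  qed (simp add: B.awalk_Nil_iff)
  have acyclic: "\<not> (B.cycle p \<and> distinct (map fst p))" for p
  proof
    assume "B.cycle p \<and> distinct (map fst p)"
    then obtain u where p: "B.awalk u p u" "p \<noteq> []" "distinct (map fst p)" by (auto simp: B.cycle_def)
    have adj: "distinct_adj (map fst p)"
      unfolding distinct_adj_conv_nth using p(3) by (metis Suc_lessD n_not_Suc_n nth_eq_iff_index_eq)
    show False
    \<comment> \<open>If the walk starts forward or ends backward, its direction is constant.
      Otherwise its first and last arcs both have head \<open>u\<close>, so they are one arc used at
      two positions.\<close>
    proof (cases "snd (hd p) \<or> \<not> snd (last p)")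
      case True
      then have "(\<forall>s\<in>set p. snd s) \<or> (\<forall>s\<in>set p. \<not> snd s)"
        using walk_stays_forward[OF unique p(1) adj p(2)] walk_stays_backward[OF unique p(1) adj p(2)] by blast
      then show False using fwd_dep[OF p(1)] bwd_dep[OF p(1)] p(2) by auto
    next
      case False
      obtain a b where ab: "hd p = (a, False)" "last p = (b, True)"
        using False by (metis prod.collapse)
      obtain q where q: "p = q @ [(b, True)]" using ab(2) p(2) by (metis append_butlast_last_id)
      have "q \<noteq> []" using ab q by auto
      then obtain q' where q': "q = (a, False) # q'" using ab(1) q by (metis hd_append2 list.collapse)
      have "head G a = u" "a \<in> arcs G" using p(1) unfolding q q' by (auto simp: B.awalk_simps)
      moreover have "head G b = u" "b \<in> arcs G" using p(1) unfolding q by (auto simp: B.awalk_simps)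
      ultimately have "a = b" using unique by blast
      then show False using p(3) unfolding q q' by simp
    qed
  qed
  have sym: "symmetric (with_proj (mk_symmetric G))" by (rule symmetric_mk_symmetric)
  interpret M: pair_wf_digraph "mk_symmetric G" by (rule wellformed_mk_symmetric)
  have "Digraph_Component.connected G"
    unfolding Digraph_Component.connected_def
  proof (rule strongly_connectedI)
    show "verts (with_proj (mk_symmetric G)) \<noteq> {}" using z by auto
    fix u v assume "u \<in> verts (with_proj (mk_symmetric G))" "v \<in> verts (with_proj (mk_symmetric G))"
    then have "z \<rightarrow>\<^sup>* u" "z \<rightarrow>\<^sup>* v" using reach by auto
    then have "z \<rightarrow>\<^sup>*\<^bsub>with_proj (mk_symmetric G)\<^esub> u" "z \<rightarrow>\<^sup>*\<^bsub>with_proj (mk_symmetric G)\<^esub> v"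
      using reachable_mk_symmetricI by simp_all
    then show "u \<rightarrow>\<^sup>*\<^bsub>with_proj (mk_symmetric G)\<^esub> v"
      using symmetric_reachable[OF sym] M.reachable_trans by blast
  qed
  moreover have "\<forall>s\<in>set p. snd s" if p: "B.apath z p v" for v p
  proof (cases p)
    case (Cons s q)
    have "snd (hd p)"
      using p Cons root by (cases s; cases "snd s") (auto simp: B.apath_Cons_iff)
    then show ?thesis
      using walk_stays_forward[OF unique B.awalkI_apath[OF p] apath_distinct_adj[OF p]] Cons by blast
  qed simp
  ultimately show ?thesis
    unfolding arborescence_from_def undirected_tree_def using z acyclic by blast
qed

end

section \<open>The matrix tree theorem\<close>

text \<open>Nodes are numbered from 1, matrix rows from 0.\<close>

definition node_det :: "nat \<Rightarrow> (nat \<Rightarrow> nat \<Rightarrow> int) \<Rightarrow> int"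
  where "node_det k A = row_det k (\<lambda>i j. A (Suc i) (Suc j))"

lemma prod_nodes: "(\<Prod>i=0..<k. h (Suc i)) = (\<Prod>v=1..k. h v)"
  by (simp add: prod.atLeast1_atMost_eq lessThan_atLeast0)

lemma sum_nodes: "(\<Sum>i=0..<k. h (Suc i)) = (\<Sum>v=1..k. h v)"
  by (simp add: sum.atLeast1_atMost_eq lessThan_atLeast0)

lemma node_det_def':
  "node_det k A = (\<Sum>p | p permutes {0..<k}. signof p * (\<Prod>v=1..k. A v (Suc (p (v - 1)))))"
proof -
  have "(\<Prod>i=0..<k. A (Suc i) (Suc (p i))) = (\<Prod>v=1..k. A v (Suc (p (v - 1))))" for p
    using prod_nodes[of "\<lambda>v. A v (Suc (p (v - 1)))"] by simp
  moreover have "node_det k A = (\<Sum>p | p permutes {0..<k}. signof p * (\<Prod>i=0..<k. A (Suc i) (Suc (p i))))"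
    unfolding node_det_def row_det_def
    by (subst det_def'[of _ k]) (auto intro!: sum.cong prod.cong simp: permutes_in_image)
  ultimately show ?thesis by simp
qed

text \<open>Multilinearity in all rows at once: a product of sums is the sum over all choice
  functions.\<close>

lemma node_det_sum_rows:
  assumes fin: "\<And>i. i \<in> {1..k} \<Longrightarrow> finite (I i)"
    and A: "\<And>i j. i \<in> {1..k} \<Longrightarrow> j \<in> {1..k} \<Longrightarrow> A i j = (\<Sum>a\<in>I i. g i a j)"
  shows "node_det k A = (\<Sum>f\<in>PiE {1..k} I. node_det k (\<lambda>i. g i (f i)))"
proof -
  have "node_det k A = (\<Sum>p | p permutes {0..<k}. signof p *
      (\<Prod>v=1..k. \<Sum>a\<in>I v. g v a (Suc (p (v - 1)))))"
    unfolding node_det_def'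
  proof (intro sum.cong refl arg_cong2[where f = "(*)"] prod.cong)
    fix p v assume p: "p \<in> {p. p permutes {0..<k}}" and v: "v \<in> {1..k}"
    have "v - 1 \<in> {0..<k}" using v by auto
    then have "p (v - 1) \<in> {0..<k}" using p permutes_in_image[of p "{0..<k}"] by simp
    then show "A v (Suc (p (v - 1))) = (\<Sum>a\<in>I v. g v a (Suc (p (v - 1))))"
      using A[OF v, of "Suc (p (v - 1))"] by simp
  qed
  also have "\<dots> = (\<Sum>p | p permutes {0..<k}. \<Sum>f\<in>PiE {1..k} I. signof p *
      (\<Prod>v=1..k. g v (f v) (Suc (p (v - 1)))))"
    by (subst prod_sum_PiE) (auto simp: fin sum_distrib_left)
  also have "\<dots> = (\<Sum>f\<in>PiE {1..k} I. node_det k (\<lambda>i. g i (f i)))"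
    unfolding node_det_def' by (rule sum.swap)
  finally show ?thesis .
qed

lemma node_det_eq_0_iff:
  "node_det k A = 0 \<longleftrightarrow>
    (\<exists>x. (\<exists>j\<in>{1..k}. x j \<noteq> 0) \<and> (\<forall>i\<in>{1..k}. (\<Sum>j=1..k. A i j * x j) = 0))"
proof -
  let ?M = "Matrix.mat k k (\<lambda>(i, j). A (Suc i) (Suc j))"
  have M: "?M \<in> carrier_mat k k" by simp
  have prod: "vec_index (?M *\<^sub>v v) i = (\<Sum>j=1..k. A (Suc i) j * vec_index v (j - 1))"
    if "v \<in> carrier_vec k" "i < k" for v i
    using that sum_nodes[of "\<lambda>j. A (Suc i) j * vec_index v (j - 1)" k]
    by (simp add: scalar_prod_def)
  have "node_det k A = 0 \<longleftrightarrow> (\<exists>v. v \<in> carrier_vec k \<and> v \<noteq> 0\<^sub>v k \<and> ?M *\<^sub>v v = 0\<^sub>v k)"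
    unfolding node_det_def row_det_def by (rule det_0_iff_vec_prod_zero[OF M])
  also have "\<dots> \<longleftrightarrow> (\<exists>x. (\<exists>j\<in>{1..k}. x j \<noteq> 0) \<and> (\<forall>i\<in>{1..k}. (\<Sum>j=1..k. A i j * x j) = 0))"
  proof
    assume "\<exists>v. v \<in> carrier_vec k \<and> v \<noteq> 0\<^sub>v k \<and> ?M *\<^sub>v v = 0\<^sub>v k"
    then obtain v where v: "v \<in> carrier_vec k" "v \<noteq> 0\<^sub>v k" "?M *\<^sub>v v = 0\<^sub>v k" by blast
    obtain j where j: "j < k" "vec_index v j \<noteq> 0" using v(1,2) by (metis carrier_vecD eq_vecI index_zero_vec)
    have "(\<Sum>j=1..k. A i j * vec_index v (j - 1)) = 0" if i: "i \<in> {1..k}" for i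
    proof -
      have i': "i - 1 < k" "Suc (i - 1) = i" using i by auto
      have "vec_index (?M *\<^sub>v v) (i - 1) = 0" unfolding v(3) using i'(1) by simp
      then show ?thesis unfolding prod[OF v(1) i'(1)] i'(2) .
    qed
    moreover have "vec_index v (Suc j - 1) \<noteq> 0" "Suc j \<in> {1..k}" using j by auto
    ultimately show "\<exists>x. (\<exists>j\<in>{1..k}. x j \<noteq> 0) \<and> (\<forall>i\<in>{1..k}. (\<Sum>j=1..k. A i j * x j) = 0)"
      by (intro exI[of _ "\<lambda>j. vec_index v (j - 1)"]) blast
  next
    assume "\<exists>x. (\<exists>j\<in>{1..k}. x j \<noteq> 0) \<and> (\<forall>i\<in>{1..k}. (\<Sum>j=1..k. A i j * x j) = 0)"
    then obtain x j where x: "j \<in> {1..k}" "x j \<noteq> 0" "\<And>i. i \<in> {1..k} \<Longrightarrow> (\<Sum>j=1..k. A i j * x j) = 0"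
      by blast
    define v where "v = Matrix.vec k (\<lambda>j. x (Suc j))"
    have v: "v \<in> carrier_vec k" by (simp add: v_def)
    have "vec_index v (j - 1) \<noteq> 0" "j - 1 < k" using x(1,2) by (auto simp: v_def)
    then have "v \<noteq> 0\<^sub>v k" by auto
    moreover have "?M *\<^sub>v v = 0\<^sub>v k"
    proof (rule eq_vecI)
      fix i assume "i < dim_vec (0\<^sub>v k :: int Matrix.vec)"
      then have i: "i < k" by simp
      have "vec_index (?M *\<^sub>v v) i = (\<Sum>j=1..k. A (Suc i) j * x j)"
        unfolding prod[OF v i] by (rule sum.cong) (auto simp: v_def)
      then show "vec_index (?M *\<^sub>v v) i = vec_index (0\<^sub>v k) i" using x(3)[of "Suc i"] i by simp
    qed simp
    ultimately show "\<exists>v. v \<in> carrier_vec k \<and> v \<noteq> 0\<^sub>v k \<and> ?M *\<^sub>v v = 0\<^sub>v k" using v by blast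
  qed
  finally show ?thesis .
qed

text \<open>
  A choice picks one arc into every node. The root gets the fictitious loop \<open>(z, z, 0)\<close>, which is not an arc of
  \<^const>\<open>count_digraph\<close>, so that \<open>parent\<close> fixes it.
\<close>

definition in_choices :: "nat \<Rightarrow> (nat \<Rightarrow> nat \<Rightarrow> nat) \<Rightarrow> nat \<Rightarrow> nat \<Rightarrow> (nat \<times> nat \<times> nat) set"
  where "in_choices k n z i = (if i = z then {(z, z, 0)} else (\<lambda>(j, m). (i, j, m)) ` Sigma ({1..k} - {i}) (\<lambda>j. {..<n i j}))"

definition parent :: "(nat \<Rightarrow> nat \<times> nat \<times> nat) \<Rightarrow> nat \<Rightarrow> nat"
  where "parent f i = fst (snd (f i))"

definition reaches_root :: "nat \<Rightarrow> nat \<Rightarrow> (nat \<Rightarrow> nat \<times> nat \<times> nat) \<Rightarrow> bool"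
  where "reaches_root k z f \<longleftrightarrow> (\<forall>i\<in>{1..k}. \<exists>m. (parent f ^^ m) i = z)"

text \<open>By expansion along row \<open>z\<close> its determinant is that of the Laplacian with
  row and column \<open>z\<close> deleted.\<close>

definition rooted_laplacian :: "nat \<Rightarrow> (nat \<Rightarrow> nat \<Rightarrow> nat) \<Rightarrow> nat \<Rightarrow> nat \<Rightarrow> nat \<Rightarrow> int"
  where "rooted_laplacian k n z i j =
    (if i = z then of_bool (i = j) else if i = j then \<Sum>l\<in>{1..k} - {i}. int (n i l) else - int (n i j))"

text \<open>The contribution of one arc \<open>a\<close> to row \<open>i\<close>: the unit vector at
  \<open>i\<close> minus that at the tail. For the fictitious loop at the root nothing is
  subtracted.\<close>

definition arc_row :: "nat \<Rightarrow> nat \<Rightarrow> nat \<times> nat \<times> nat \<Rightarrow> nat \<Rightarrow> int"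
  where "arc_row z i a j = of_bool (i = j) - of_bool (i \<noteq> z \<and> fst (snd a) = j)"

lemma finite_in_choices: "finite (in_choices k n z i)"
  by (simp add: in_choices_def)

text \<open>Summing over arcs rather than tails makes each parallel arc a choice of its own, as
  counting arborescences requires.\<close>

lemma rooted_laplacian_eq_sum:
  assumes "i \<in> {1..k}" "j \<in> {1..k}"
  shows "rooted_laplacian k n z i j = (\<Sum>a\<in>in_choices k n z i. arc_row z i a j)"
proof (cases "i = z")
  case True
  then show ?thesis by (simp add: rooted_laplacian_def in_choices_def arc_row_def)
next
  case False
  have "(\<Sum>a\<in>in_choices k n z i. arc_row z i a j)
    = (\<Sum>(l, m)\<in>Sigma ({1..k} - {i}) (\<lambda>l. {..<n i l}). of_bool (i = j) - of_bool (l = j))"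
    using False by (simp add: in_choices_def arc_row_def sum.reindex inj_on_def split_def)
  also have "\<dots> = (\<Sum>l\<in>{1..k} - {i}. \<Sum>m<n i l. of_bool (i = j) - of_bool (l = j))"
    by (rule sum.Sigma[symmetric]) auto
  also have "\<dots> = (\<Sum>l\<in>{1..k} - {i}. int (n i l) * (of_bool (i = j) - of_bool (l = j)))"
    by simp
  also have "\<dots> = rooted_laplacian k n z i j"
  proof (cases "i = j")
    case True
    then show ?thesis using False
      by (auto simp: rooted_laplacian_def intro!: sum.cong)
  next
    case neq: False
    have "(\<Sum>l\<in>{1..k} - {i}. int (n i l) * (of_bool (i = j) - of_bool (l = j)))
      = (\<Sum>l\<in>{1..k} - {i}. if l = j then - int (n i l) else 0)"
      using neq by (intro sum.cong) auto
    also have "\<dots> = - int (n i j)" using assms neq by (subst sum.delta) auto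
    finally show ?thesis using False neq by (simp add: rooted_laplacian_def)
  qed
  finally show ?thesis by simp
qed

lemma parent_in_nodes:
  assumes "f \<in> PiE {1..k} (in_choices k n z)" "i \<in> {1..k}"
  shows "parent f i \<in> {1..k}"
  using PiE_mem[OF assms] assms(2) by (auto simp: in_choices_def parent_def split: if_splits)

lemma parent_root:
  assumes "f \<in> PiE {1..k} (in_choices k n z)" "z \<in> {1..k}"
  shows "parent f z = z"
  using PiE_mem[OF assms] by (auto simp: in_choices_def parent_def)

text \<open>If all nodes reach the root, ordering them by distance makes the matrix triangular with
  unit diagonal. Otherwise the indicator of the nodes that never reach it is a kernel
  vector.\<close>

lemma node_det_choice:
  assumes z: "z \<in> {1..k}" and f: "f \<in> PiE {1..k} (in_choices k n z)"
  shows "node_det k (\<lambda>i. arc_row z i (f i)) = of_bool (reaches_root k z f)"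
proof (cases "reaches_root k z f")
  case True
  define dep where "dep i = (LEAST m. (parent f ^^ m) i = z)" for i
  have dep: "(parent f ^^ dep i) i = z" if "i \<in> {1..k}" for i
    unfolding dep_def by (rule LeastI_ex) (use True that in \<open>auto simp: reaches_root_def\<close>)
  have dep_parent: "dep (parent f i) < dep i" if i: "i \<in> {1..k}" "i \<noteq> z" for i
  proof -
    obtain m where m: "dep i = Suc m" using dep[OF i(1)] i(2) by (cases "dep i") auto
    have "(parent f ^^ m) (parent f i) = z" using dep[OF i(1)] m by (simp add: funpow_swap1)
    then have "dep (parent f i) \<le> m" unfolding dep_def by (rule Least_le)
    then show ?thesis using m by simp
  qed
  \<comment> \<open>Take a node \<open>v\<close> of least depth moved by \<open>p\<close>. A nonzero
    factor forces \<open>p\<close> to send it to its parent, which has smaller depth and so is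
    fixed, against injectivity.\<close>
  have zero: "(\<Prod>v=1..k. arc_row z v (f v) (Suc (p (v - 1)))) = 0"
    if p: "p permutes {0..<k}" "p \<noteq> id" for p
  proof (rule ccontr)
    assume "(\<Prod>v=1..k. arc_row z v (f v) (Suc (p (v - 1)))) \<noteq> 0"
    then have nz: "arc_row z v (f v) (Suc (p (v - 1))) \<noteq> 0" if "v \<in> {1..k}" for v
      using that by auto
    obtain i where i: "p i \<noteq> i" using p(2) by (auto simp: fun_eq_iff)
    then have ik: "i < k" using p(1) by (metis atLeastLessThan_iff le0 permutes_not_in)
    define Q where "Q v \<longleftrightarrow> v \<in> {1..k} \<and> p (v - 1) \<noteq> v - 1" for v
    have "Q (Suc i)" using i ik by (simp add: Q_def)
    then obtain v where v: "Q v" "\<And>w. Q w \<Longrightarrow> dep v \<le> dep w"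
      using ex_has_least_nat[of Q "Suc i" dep] by blast
    have vk: "v \<in> {1..k}" "p (v - 1) \<noteq> v - 1" using v(1) by (auto simp: Q_def)
    have "v \<noteq> Suc (p (v - 1))" using vk by auto
    then have par: "v \<noteq> z" "parent f v = Suc (p (v - 1))"
      using nz[OF vk(1)] by (auto simp: arc_row_def parent_def split: if_splits)
    then have "\<not> Q (parent f v)" using v(2)[of "parent f v"] dep_parent[OF vk(1)] by linarith
    then have "p (p (v - 1)) = p (v - 1)"
      using par(2) parent_in_nodes[OF f vk(1)] by (simp add: Q_def)
    then show False using vk(2) permutes_inj[OF p(1)] by (metis injD)
  qed
  have diag: "arc_row z v (f v) v = 1" if v: "v \<in> {1..k}" for v
    using dep_parent[OF v] by (auto simp: arc_row_def parent_def)
  have "node_det k (\<lambda>i. arc_row z i (f i))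
    = (\<Sum>p | p permutes {0..<k}. if p = id then 1 else 0)"
    unfolding node_det_def'
  proof (rule sum.cong[OF refl])
    fix p assume p: "p \<in> {p. p permutes {0..<k}}"
    show "signof p * (\<Prod>v=1..k. arc_row z v (f v) (Suc (p (v - 1)))) = (if p = id then 1 else 0)"
    proof (cases "p = id")
      case True
      have "(\<Prod>v=1..k. arc_row z v (f v) (Suc (p (v - 1)))) = 1"
        using diag True by (intro prod.neutral) auto
      then show ?thesis using True by (simp add: sign_id)
    next
      case False
      then show ?thesis using zero p by simp
    qed
  qed
  also have "\<dots> = 1" by (simp add: finite_permutations permutes_id)
  finally show ?thesis using True by simp
next
  case False
  \<comment> \<open>A node other than \<open>z\<close> belongs to \<open>B\<close> exactly when its
    parent does, so every row vanishes on the indicator of \<open>B\<close>.\<close>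
  define B where "B = {i \<in> {1..k}. \<forall>m. (parent f ^^ m) i \<noteq> z}"
  obtain b where b: "b \<in> B" using False by (auto simp: reaches_root_def B_def)
  have zB: "z \<notin> B" using parent_root[OF f z] by (auto simp: B_def intro!: exI[of _ 0])
  have par_B: "parent f i \<in> B \<longleftrightarrow> i \<in> B" if i: "i \<in> {1..k}" "i \<noteq> z" for i
  proof
    assume "i \<in> B"
    then have "(parent f ^^ m) (parent f i) \<noteq> z" for m
      unfolding B_def by (metis (mono_tags, lifting) comp_apply funpow_Suc_right mem_Collect_eq)
    then show "parent f i \<in> B" using parent_in_nodes[OF f i(1)] by (simp add: B_def)
  next
    assume pB: "parent f i \<in> B"
    have "(parent f ^^ m) i \<noteq> z" for m
      using pB i(2) by (cases m) (auto simp: B_def funpow_Suc_right simp del: funpow.simps(2))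
    then show "i \<in> B" using i(1) by (simp add: B_def)
  qed
  have "(\<Sum>j=1..k. arc_row z i (f i) j * of_bool (j \<in> B)) = 0" if i: "i \<in> {1..k}" for i
  proof -
    have "(\<Sum>j=1..k. arc_row z i (f i) j * of_bool (j \<in> B))
      = (\<Sum>j=1..k. (if j = i then of_bool (i \<in> B) else 0)) -
        (\<Sum>j=1..k. (if j = parent f i then of_bool (i \<noteq> z \<and> parent f i \<in> B) else 0))"
      unfolding sum_subtractf[symmetric] by (rule sum.cong) (auto simp: arc_row_def parent_def)
    also have "\<dots> = of_bool (i \<in> B) - of_bool (i \<noteq> z \<and> parent f i \<in> B)"
      using i parent_in_nodes[OF f i] by (simp only: sum.delta finite_atLeastAtMost if_True)
    also have "\<dots> = 0" using par_B[OF i] zB by auto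
    finally show ?thesis .
  qed
  moreover have "b \<in> {1..k}" "(of_bool (b \<in> B) :: int) \<noteq> 0" using b by (auto simp: B_def)
  ultimately have "node_det k (\<lambda>i. arc_row z i (f i)) = 0"
    unfolding node_det_eq_0_iff by (intro exI[of _ "\<lambda>j. of_bool (j \<in> B)"]) blast
  then show ?thesis using False by simp
qed

lemma node_det_rooted_laplacian:
  assumes "z \<in> {1..k}"
  shows "node_det k (rooted_laplacian k n z)
    = int (card {f \<in> PiE {1..k} (in_choices k n z). reaches_root k z f})"
proof -
  have "finite (PiE {1..k} (in_choices k n z))" by (simp add: finite_PiE finite_in_choices)
  moreover have "node_det k (rooted_laplacian k n z)
    = (\<Sum>f\<in>PiE {1..k} (in_choices k n z). node_det k (\<lambda>i. arc_row z i (f i)))"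
    by (rule node_det_sum_rows) (auto simp: finite_in_choices rooted_laplacian_eq_sum)
  ultimately show ?thesis
    using node_det_choice[OF assms] by (simp add: sum.If_cases of_bool_def Int_def conj_commute)
qed

text \<open>Where a positive maximum is attained, all terms of the vanishing sum are nonnegative, so
  each is zero and the maximum spreads to the tails of all incoming arcs. The cut condition gives
  such a tail outside the set of maximal nodes.\<close>

lemma rooted_laplacian_max_principle:
  fixes n :: "nat \<Rightarrow> nat \<Rightarrow> nat"
  assumes z: "z \<in> {1..k}"
    and cut: "\<And>A. \<lbrakk>A \<subseteq> {1..k}; A \<noteq> {}; z \<notin> A\<rbrakk> \<Longrightarrow> \<exists>i\<in>A. \<exists>j\<in>{1..k} - A. 0 < n i j"
    and x: "x z = 0" "\<And>i. i \<in> {1..k} \<Longrightarrow> i \<noteq> z \<Longrightarrow> (\<Sum>l\<in>{1..k} - {i}. int (n i l) * (x i - x l)) = 0"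
    and j: "j \<in> {1..k}"
  shows "x j \<le> (0::int)"
proof (rule ccontr)
  assume neg: "\<not> x j \<le> 0"
  define m where "m = Max (x ` {1..k})"
  have m_ge: "x i \<le> m" if "i \<in> {1..k}" for i using that unfolding m_def by (intro Max_ge) auto
  have "m \<in> x ` {1..k}" unfolding m_def using z by (intro Max_in) auto
  then obtain i0 where i0: "i0 \<in> {1..k}" "x i0 = m" by blast
  have "0 < m" using m_ge[OF j] neg by linarith
  define A where "A = {i \<in> {1..k}. x i = m}"
  have "A \<subseteq> {1..k}" "A \<noteq> {}" "z \<notin> A" using i0 x(1) \<open>0 < m\<close> by (auto simp: A_def)
  from cut[OF this] obtain i l where il: "i \<in> A" "l \<in> {1..k} - A" "0 < n i l" by blast
  have i: "i \<in> {1..k}" "x i = m" "i \<noteq> z" using il \<open>z \<notin> A\<close> by (auto simp: A_def)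
  have "\<forall>l\<in>{1..k} - {i}. int (n i l) * (x i - x l) = 0"
    using x(2)[OF i(1,3)] m_ge i(2) by (subst sum_nonneg_eq_0_iff[symmetric]) auto
  moreover have "l \<in> {1..k} - {i}" using il by auto
  ultimately have "int (n i l) * (x i - x l) = 0" by blast
  then have "x l = m" using il(3) i(2) by simp
  then show False using il(2) unfolding A_def by blast
qed

text \<open>A kernel vector is zero at \<open>z\<close> and harmonic elsewhere; the maximum
  principle applies to it and to its negative.\<close>

lemma node_det_rooted_laplacian_nonzero:
  fixes n :: "nat \<Rightarrow> nat \<Rightarrow> nat"
  assumes z: "z \<in> {1..k}"
    and cut: "\<And>A. \<lbrakk>A \<subseteq> {1..k}; A \<noteq> {}; z \<notin> A\<rbrakk> \<Longrightarrow> \<exists>i\<in>A. \<exists>j\<in>{1..k} - A. 0 < n i j"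
  shows "node_det k (rooted_laplacian k n z) \<noteq> 0"
proof
  assume "node_det k (rooted_laplacian k n z) = 0"
  then obtain x j where j: "j \<in> {1..k}" "x j \<noteq> 0"
    and x: "\<And>i. i \<in> {1..k} \<Longrightarrow> (\<Sum>j=1..k. rooted_laplacian k n z i j * x j) = 0"
    unfolding node_det_eq_0_iff by blast
  have "(\<Sum>j=1..k. rooted_laplacian k n z z j * x j) = (\<Sum>j=1..k. if j = z then x j else 0)"
    by (rule sum.cong) (auto simp: rooted_laplacian_def)
  then have xz: "x z = 0" using x[OF z] z by (simp add: sum.delta)
  have harm: "(\<Sum>l\<in>{1..k} - {i}. int (n i l) * (x i - x l)) = 0" if i: "i \<in> {1..k}" "i \<noteq> z" for i
  proof -
    have "(\<Sum>j=1..k. rooted_laplacian k n z i j * x j)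
      = rooted_laplacian k n z i i * x i + (\<Sum>l\<in>{1..k} - {i}. rooted_laplacian k n z i l * x l)"
      using i(1) by (subst sum.remove[of _ i]) auto
    also have "\<dots> = (\<Sum>l\<in>{1..k} - {i}. int (n i l)) * x i + (\<Sum>l\<in>{1..k} - {i}. - int (n i l) * x l)"
      using i(2) by (auto simp: rooted_laplacian_def intro!: sum.cong)
    also have "\<dots> = (\<Sum>l\<in>{1..k} - {i}. int (n i l) * (x i - x l))"
      by (simp add: sum_distrib_right sum.distrib[symmetric] right_diff_distrib)
    finally show ?thesis using x[OF i(1)] by simp
  qed
  have "x j \<le> 0" by (rule rooted_laplacian_max_principle[OF z cut xz harm j(1)])
  moreover have "- x j \<le> 0"
  proof (rule rooted_laplacian_max_principle[OF z cut _ _ j(1)])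
    fix i assume i: "i \<in> {1..k}" "i \<noteq> z"
    have "(\<Sum>l\<in>{1..k} - {i}. int (n i l) * (- x i - - x l)) = - (\<Sum>l\<in>{1..k} - {i}. int (n i l) * (x i - x l))"
      unfolding sum_negf[symmetric] by (rule sum.cong) (auto simp: algebra_simps)
    then show "(\<Sum>l\<in>{1..k} - {i}. int (n i l) * (- x i - - x l)) = 0" using harm[OF i] by simp
  qed (use xz in auto)
  ultimately show False using j(2) by simp
qed

section \<open>Choices of in-arcs as spanning arborescences\<close>

lemma count_digraph_simps [simp]:
  "verts (count_digraph k n) = {1..k}"
  "tail (count_digraph k n) a = fst (snd a)" "head (count_digraph k n) a = fst a"
  by (simp_all add: count_digraph_def split_def)

lemma arcs_count_digraph:
  "a \<in> arcs (count_digraph k n) \<longleftrightarrow>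
    fst a \<in> {1..k} \<and> fst (snd a) \<in> {1..k} \<and> fst a \<noteq> fst (snd a) \<and> snd (snd a) < n (fst a) (fst (snd a))"
  by (simp add: count_digraph_def split_def)

lemma wf_count_digraph: "wf_digraph (count_digraph k n)"
  by unfold_locales (auto simp: arcs_count_digraph)

lemma mem_in_choices:
  assumes "i \<noteq> z" "i \<in> {1..k}"
  shows "a \<in> in_choices k n z i \<longleftrightarrow> a \<in> arcs (count_digraph k n) \<and> fst a = i"
  using assms by (cases a) (auto simp: in_choices_def arcs_count_digraph)

definition choice_digraph :: "nat \<Rightarrow> (nat \<Rightarrow> nat \<Rightarrow> nat) \<Rightarrow> nat \<Rightarrow> (nat \<Rightarrow> nat \<times> nat \<times> nat) \<Rightarrow> (nat, nat \<times> nat \<times> nat) pre_digraph"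
  where "choice_digraph k n z f = (count_digraph k n)\<lparr>arcs := f ` ({1..k} - {z})\<rparr>"

lemma choice_digraph_simps [simp]:
  "verts (choice_digraph k n z f) = {1..k}" "arcs (choice_digraph k n z f) = f ` ({1..k} - {z})"
  "tail (choice_digraph k n z f) = tail (count_digraph k n)"
  "head (choice_digraph k n z f) = head (count_digraph k n)"
  by (simp_all add: choice_digraph_def)

context
  fixes k z :: nat and n :: "nat \<Rightarrow> nat \<Rightarrow> nat"
  assumes z: "z \<in> {1..k}"
begin

lemma choice_arc:
  assumes "f \<in> PiE {1..k} (in_choices k n z)" "i \<in> {1..k}" "i \<noteq> z"
  shows "f i \<in> arcs (count_digraph k n)" "fst (f i) = i"
  using PiE_mem[OF assms(1,2)] unfolding mem_in_choices[OF assms(3,2)] by simp_all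

lemma spanning_choice_digraph:
  assumes f: "f \<in> PiE {1..k} (in_choices k n z)"
  shows "spanning (choice_digraph k n z f) (count_digraph k n)"
proof -
  have sub: "f ` ({1..k} - {z}) \<subseteq> arcs (count_digraph k n)" using choice_arc[OF f] by blast
  have "wf_digraph (choice_digraph k n z f)"
  proof
    fix a assume "a \<in> arcs (choice_digraph k n z f)"
    then have "a \<in> arcs (count_digraph k n)" using sub by auto
    then show "tail (choice_digraph k n z f) a \<in> verts (choice_digraph k n z f)"
      "head (choice_digraph k n z f) a \<in> verts (choice_digraph k n z f)"
      using arcs_count_digraph by simp_all
  qed
  then show ?thesis
    unfolding spanning_def subgraph_def compatible_def using sub wf_count_digraph by simp
qed

lemma arborescence_choice_digraph:
  assumes f: "f \<in> PiE {1..k} (in_choices k n z)" and reach: "reaches_root k z f"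
  shows "arborescence_from z (choice_digraph k n z f)"
proof -
  let ?H = "choice_digraph k n z f"
  interpret H: wf_digraph ?H
    using spanning_choice_digraph[OF f] by (auto simp: spanning_def subgraph_def)
  have up: "z \<rightarrow>\<^sup>*\<^bsub>?H\<^esub> v" if "v \<in> {1..k}" "(parent f ^^ m) v = z" for v m
    using that
  proof (induction m arbitrary: v)
    case 0
    then show ?case using H.reachable_refl by simp
  next
    case (Suc m)
    show ?case
    proof (cases "v = z")
      case True
      then show ?thesis using Suc.prems H.reachable_refl by simp
    next
      case False
      have "(parent f ^^ m) (parent f v) = z" using Suc.prems(2) by (simp add: funpow_swap1)
      then have "z \<rightarrow>\<^sup>*\<^bsub>?H\<^esub> parent f v" using Suc.IH parent_in_nodes[OF f Suc.prems(1)] by blast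
      moreover have "parent f v \<rightarrow>\<^bsub>?H\<^esub> v"
      proof -
        have "f v \<in> arcs ?H" using Suc.prems(1) False by simp
        from H.in_arcs_imp_in_arcs_ends[OF this] show ?thesis
          using choice_arc(2)[OF f Suc.prems(1) False] by (simp add: parent_def)
      qed
      ultimately show ?thesis by (rule H.reachable_adj_trans)
    qed
  qed
  have fst_f: "fst (f i) = i" if "i \<in> {1..k} - {z}" for i using choice_arc(2)[OF f] that by blast
  show ?thesis
  proof (rule H.arborescenceI)
    show "z \<in> verts ?H" using z by simp
    show "z \<rightarrow>\<^sup>*\<^bsub>?H\<^esub> v" if v: "v \<in> verts ?H" for v
    proof -
      have "v \<in> {1..k}" using v by simp
      then obtain m where "(parent f ^^ m) v = z" using reach unfolding reaches_root_def by blast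
      then show ?thesis using up \<open>v \<in> {1..k}\<close> by blast
    qed
    show "head ?H a \<noteq> z" if a: "a \<in> arcs ?H" for a
    proof -
      obtain i where "i \<in> {1..k} - {z}" "a = f i"
        using a unfolding choice_digraph_simps by blast
      then show ?thesis using fst_f by simp
    qed
    show "a = b" if ab: "a \<in> arcs ?H" "b \<in> arcs ?H" "head ?H a = head ?H b" for a b
    proof -
      obtain i j where "i \<in> {1..k} - {z}" "a = f i" "j \<in> {1..k} - {z}" "b = f j"
        using ab(1,2) unfolding choice_digraph_simps by blast
      then show ?thesis using ab(3) fst_f by simp
    qed
  qed
qed

text \<open>The choice assigns to each node other than \<open>z\<close> its only arc in
  \<open>H\<close>; directed walks from \<open>z\<close>, read backwards, are the iterates of
  \<open>parent\<close>.\<close>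

lemma spanning_arborescence_choice:
  assumes sp: "spanning H (count_digraph k n)" and arb: "arborescence_from z H"
  shows "\<exists>f \<in> PiE {1..k} (in_choices k n z). reaches_root k z f \<and> H = choice_digraph k n z f"
proof -
  have H: "verts H = {1..k}" "arcs H \<subseteq> arcs (count_digraph k n)"
    "tail H = tail (count_digraph k n)" "head H = head (count_digraph k n)" "wf_digraph H"
    using sp by (auto simp: spanning_def subgraph_def compatible_def)
  interpret H: wf_digraph H by (rule H(5))
  have reach: "z \<rightarrow>\<^sup>*\<^bsub>H\<^esub> v" if v: "v \<in> {1..k}" for v
  proof -
    have "v \<in> verts H" using v H(1) by simp
    then obtain q where "pre_digraph.apath (both_ways H) z q v" "\<forall>s\<in>set q. snd s"
      by (rule H.arborescence_forward_path[OF arb])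
    then have "H.awalk z (map fst q) v"
      using H.forward_walk by (simp add: pre_digraph.apath_def)
    then show ?thesis by (rule H.reachable_awalkI)
  qed
  have in_arc: "\<exists>a\<in>arcs H. fst a = v" if v: "v \<in> {1..k}" "v \<noteq> z" for v
  proof -
    obtain p where p: "H.awalk z p v" using reach[OF v(1)] H.reachable_awalk by metis
    then have "p \<noteq> []" using v(2) by (auto simp: H.awalk_Nil_iff)
    then obtain q a where "p = q @ [a]" by (metis rev_exhaust)
    then have "a \<in> arcs H" "head H a = v" using p by (auto simp: H.awalk_simps)
    then show ?thesis unfolding H(4) by auto
  qed
  \<comment> \<open>The restriction to the nodes makes \<open>f\<close> extensional, as
    \<open>PiE\<close> demands, and so determined by \<open>H\<close>.\<close>
  define f where "f = (\<lambda>i\<in>{1..k}. if i = z then (z, z, 0) else SOME a. a \<in> arcs H \<and> fst a = i)"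
  have f: "f i \<in> arcs H" "fst (f i) = i" if i: "i \<in> {1..k}" "i \<noteq> z" for i
  proof -
    have "\<exists>a. a \<in> arcs H \<and> fst a = i" using in_arc[OF i] by blast
    from someI_ex[OF this] show "f i \<in> arcs H" "fst (f i) = i" using i by (simp_all add: f_def)
  qed
  have unique: "a = b" if "a \<in> arcs H" "b \<in> arcs H" "fst a = fst b" for a b
    using H.arborescence_unique_in_arc[OF arb that(1,2)] that(3) unfolding H(4) by simp
  have root: "fst a \<noteq> z" if "a \<in> arcs H" for a
    using H.arborescence_no_arc_to_root[OF arb that] unfolding H(4) by simp
  have fPi: "f \<in> PiE {1..k} (in_choices k n z)"
  proof (rule PiE_I)
    fix i assume i: "i \<in> {1..k}"
    show "f i \<in> in_choices k n z i"
    proof (cases "i = z")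
      case True
      then show ?thesis using z by (simp add: f_def in_choices_def)
    next
      case False
      then show ?thesis using f[OF i False] H(2) mem_in_choices[OF False i] by blast
    qed
  qed (simp only: f_def restrict_apply if_False)
  have arcs: "arcs H = f ` ({1..k} - {z})"
  proof (intro equalityI subsetI)
    fix a assume a: "a \<in> arcs H"
    then have "fst a \<in> {1..k}" using H(2) arcs_count_digraph by blast
    then have "a = f (fst a)" "fst a \<in> {1..k} - {z}" using f unique a root[OF a] by auto
    then show "a \<in> f ` ({1..k} - {z})" by blast
  qed (use f in blast)
  have "reaches_root k z f"
    unfolding reaches_root_def
  proof
    fix v assume "v \<in> {1..k}"
    from reach[OF this] show "\<exists>m. (parent f ^^ m) v = z"
    proof (induction rule: H.reachable_induct)
      case base
      show ?case by (intro exI[of _ 0]) simp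
    next
      case (step x y)
      then obtain m where m: "(parent f ^^ m) x = z" by blast
      obtain a where a: "a \<in> arcs H" "tail H a = x" "head H a = y" using step(2) by (rule reachableE)
      then obtain i where i: "i \<in> {1..k} - {z}" "a = f i" using arcs by blast
      have "fst a = y" "fst (snd a) = x" using a(2,3) unfolding H(3,4) by simp_all
      then have "parent f y = x" using i f(2) by (auto simp: parent_def)
      then have "(parent f ^^ Suc m) y = z" using m by (simp add: funpow_swap1)
      then show ?case by blast
    qed
  qed
  moreover have "H = choice_digraph k n z f"
    using H(1,3,4) arcs by (intro pre_digraph.equality) simp_all
  ultimately show ?thesis using fPi by blast
qed

lemma tree_number_eq_card_choices:
  "tree_number (count_digraph k n) z = card {f \<in> PiE {1..k} (in_choices k n z). reaches_root k z f}"
proof -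
  let ?F = "{f \<in> PiE {1..k} (in_choices k n z). reaches_root k z f}"
  have "choice_digraph k n z ` ?F = {H. spanning H (count_digraph k n) \<and> arborescence_from z H}"
  proof (intro equalityI subsetI)
    fix H assume "H \<in> choice_digraph k n z ` ?F"
    then obtain f where f: "f \<in> PiE {1..k} (in_choices k n z)" "reaches_root k z f" "H = choice_digraph k n z f"
      by blast
    then show "H \<in> {H. spanning H (count_digraph k n) \<and> arborescence_from z H}"
      using spanning_choice_digraph[OF f(1)] arborescence_choice_digraph[OF f(1,2)] by blast
  next
    fix H assume "H \<in> {H. spanning H (count_digraph k n) \<and> arborescence_from z H}"
    then show "H \<in> choice_digraph k n z ` ?F" using spanning_arborescence_choice[of H] by blast
  qed
  moreover have "inj_on (choice_digraph k n z) ?F"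
  proof (rule inj_onI)
    fix f g assume fg: "f \<in> ?F" "g \<in> ?F" and eq: "choice_digraph k n z f = choice_digraph k n z g"
    then have f: "f \<in> PiE {1..k} (in_choices k n z)" and g: "g \<in> PiE {1..k} (in_choices k n z)" by auto
    have im: "f ` ({1..k} - {z}) = g ` ({1..k} - {z})"
      using arg_cong[OF eq, of arcs] by simp
    show "f = g"
    proof (rule PiE_ext[OF f g])
      fix i assume i: "i \<in> {1..k}"
      show "f i = g i"
      proof (cases "i = z")
        case True
        then show ?thesis using PiE_mem[OF f i] PiE_mem[OF g i] by (simp add: in_choices_def)
      next
        case False
        then have "f i \<in> g ` ({1..k} - {z})" using im i by blast
        then obtain j where j: "j \<in> {1..k}" "j \<noteq> z" "f i = g j" by blast
        then have "i = j" using choice_arc(2)[OF f i False] choice_arc(2)[OF g j(1,2)] by simp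
        then show ?thesis using j(3) by simp
      qed
    qed
  qed
  ultimately show ?thesis unfolding tree_number_def using card_image by fastforce
qed

lemma node_det_eq_tree_number:
  "node_det k (rooted_laplacian k n z) = int (tree_number (count_digraph k n) z)"
  unfolding tree_number_eq_card_choices using node_det_rooted_laplacian[OF z] .

end

section \<open>The presented group\<close>

text \<open>The powers of \<open>e\<close> form a section of \<phi>, so dividing \<open>x\<close> by
  the power of exponent \<open>\<phi> x\<close> projects onto the kernel.\<close>

lemma (in comm_group) split_over_integers:
  assumes \<phi>: "\<phi> \<in> hom G integer_group" and e: "e \<in> carrier G" "\<phi> e = 1"
  shows "G \<cong> integer_group \<times>\<times> (G\<lparr>carrier := kernel G integer_group \<phi>\<rparr>)"
proof -
  interpret \<phi>: group_hom G integer_group \<phi>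
    using \<phi> by (intro group_hom.intro group_hom_axioms.intro) auto
  let ?Z = "integer_group \<times>\<times> (G\<lparr>carrier := kernel G integer_group \<phi>\<rparr>)"
  define h where "h = (\<lambda>x. (\<phi> x, x \<otimes> inv (e [^] \<phi> x)))"
  have \<phi>_pow: "\<phi> (e [^] m) = m" for m :: int
    using \<phi>.hom_int_pow[OF e(1), of m] e(2) by simp
  have \<phi>_mult: "\<phi> (x \<otimes> y) = \<phi> x + \<phi> y" if "x \<in> carrier G" "y \<in> carrier G" for x y
    using \<phi>.hom_mult[OF that] by simp
  have \<phi>_inv: "\<phi> (inv x) = - \<phi> x" if "x \<in> carrier G" for x
    using \<phi>.hom_inv[OF that] by simp
  have ep: "e [^] m \<in> carrier G" for m :: int using e(1) by simp
  have "h \<in> hom G ?Z"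
  proof (rule homI)
    fix x assume x: "x \<in> carrier G"
    then have "\<phi> (x \<otimes> inv (e [^] \<phi> x)) = 0" using ep by (simp add: \<phi>_mult \<phi>_inv \<phi>_pow)
    then show "h x \<in> carrier ?Z" using x ep by (simp add: h_def kernel_def)
  next
    fix x y assume xy: "x \<in> carrier G" "y \<in> carrier G"
    have "x \<otimes> y \<otimes> inv (e [^] (\<phi> x + \<phi> y)) = (x \<otimes> inv (e [^] \<phi> x)) \<otimes> (y \<otimes> inv (e [^] \<phi> y))"
      using xy ep[of "\<phi> x"] ep[of "\<phi> y"] by (simp add: int_pow_mult[OF e(1)] inv_mult m_ac)
    then show "h (x \<otimes> y) = h x \<otimes>\<^bsub>?Z\<^esub> h y"
      using xy by (simp add: h_def \<phi>_mult)
  qed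
  moreover have "bij_betw h (carrier G) (carrier ?Z)"
  proof (rule bij_betwI[where g = "\<lambda>(m, y). e [^] m \<otimes> y"])
    show "h \<in> carrier G \<rightarrow> carrier ?Z"
      using \<open>h \<in> hom G ?Z\<close> by (auto simp: hom_def)
    show "(\<lambda>(m, y). e [^] m \<otimes> y) \<in> carrier ?Z \<rightarrow> carrier G"
      using ep by (auto simp: kernel_def)
    fix x assume x: "x \<in> carrier G"
    show "(\<lambda>(m, y). e [^] m \<otimes> y) (h x) = x"
      using x ep[of "\<phi> x"] by (simp add: h_def m_lcomm[of _ x] )
  next
    fix p assume "p \<in> carrier ?Z"
    then obtain m y where p: "p = (m, y)" "y \<in> carrier G" "\<phi> y = 0"
      by (auto simp: kernel_def)
    have "\<phi> (e [^] m \<otimes> y) = m" using p(2,3) ep by (simp add: \<phi>_mult \<phi>_pow)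
    moreover have "e [^] m \<otimes> y \<otimes> inv (e [^] m) = y"
      using p(2) ep[of m] by (simp add: m_comm[of _ y] m_assoc)
    ultimately show "h ((\<lambda>(m, y). e [^] m \<otimes> y) p) = p" by (simp add: h_def p(1))
  qed
  ultimately show ?thesis by (intro is_isoI isoI)
qed

text \<open>This passes from the generated subgroup to integer combinations of rows, read off
  coordinate by coordinate.\<close>

lemma relation_subgroup_iff:
  "a \<in> relation_subgroup k t \<longleftrightarrow> Poly_Mapping.keys a \<subseteq> {1..k} \<and>
    (\<exists>c. \<forall>j\<in>{1..k}. Poly_Mapping.lookup a j = (\<Sum>i=1..k. c i * t i j))"
proof
  let ?F = "free_Abelian_group {1..k}"
  let ?row = "\<lambda>i. \<Sum>j=1..k. frag_cmul (t i j) (frag_of j)"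
  interpret F: comm_group ?F by (rule abelian_free_Abelian_group)
  have lookup_row: "Poly_Mapping.lookup (?row i) j = (if j \<in> {1..k} then t i j else 0)" for i j
    by (simp add: lookup_sum if_distrib[of "(*) _"] sum.delta' cong: if_cong)
  have keys_row: "Poly_Mapping.keys (?row i) \<subseteq> {1..k}" for i
  proof
    fix j assume "j \<in> Poly_Mapping.keys (?row i)"
    then have "Poly_Mapping.lookup (?row i) j \<noteq> 0" by (simp only: in_keys_iff not_False_eq_True)
    then show "j \<in> {1..k}" unfolding lookup_row by (metis (full_types))
  qed
  have pick: "(\<Sum>i=1..k. of_bool (i = l) * t i j) = t l j" if l: "l \<in> {1..k}" for l j
  proof -
    have "(\<Sum>i=1..k. of_bool (i = l) * t i j) = (\<Sum>i=1..k. if i = l then t i j else 0)"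
      by (rule sum.cong) auto
    also have "\<dots> = t l j" using l by (subst sum.delta) auto
    finally show ?thesis .
  qed
  have rows: "?row ` {1..k} \<subseteq> carrier ?F" using keys_row by auto
  have sub: "subgroup (relation_subgroup k t) ?F"
    unfolding relation_subgroup_def by (rule F.generate_is_subgroup[OF rows])
  show "Poly_Mapping.keys a \<subseteq> {1..k} \<and> (\<exists>c. \<forall>j\<in>{1..k}. Poly_Mapping.lookup a j = (\<Sum>i=1..k. c i * t i j))"
    if a: "a \<in> relation_subgroup k t"
  proof
    show "Poly_Mapping.keys a \<subseteq> {1..k}"
      using subgroup.mem_carrier[OF sub a] by simp
    show "\<exists>c. \<forall>j\<in>{1..k}. Poly_Mapping.lookup a j = (\<Sum>i=1..k. c i * t i j)"
      using a unfolding relation_subgroup_def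
    proof (induction a rule: generate.induct)
      case one
      show ?case by (intro exI[of _ "\<lambda>i. 0"]) simp
    next
      case (incl a)
      then obtain l where l: "l \<in> {1..k}" "a = ?row l" by blast
      show ?case
        unfolding l(2) lookup_row
        by (intro exI[of _ "\<lambda>i. of_bool (i = l)"] ballI) (simp only: pick[OF l(1)] if_True)
    next
      case (inv a)
      then obtain l where l: "l \<in> {1..k}" "a = ?row l" by blast
      have "inv\<^bsub>?F\<^esub> a = - ?row l" using keys_row[of l] unfolding l(2) by (rule inv_free_Abelian_group)
      then have "Poly_Mapping.lookup (inv\<^bsub>?F\<^esub> a) j = (\<Sum>i=1..k. (- of_bool (i = l)) * t i j)"
        if "j \<in> {1..k}" for j
        using that by (simp only: lookup_uminus lookup_row if_True mult_minus_left sum_negf pick[OF l(1)])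
      then show ?case by (intro exI[of _ "\<lambda>i. - of_bool (i = l)"] ballI)
    next
      case (eng a b)
      then obtain c d where "\<forall>j\<in>{1..k}. Poly_Mapping.lookup a j = (\<Sum>i=1..k. c i * t i j)"
        "\<forall>j\<in>{1..k}. Poly_Mapping.lookup b j = (\<Sum>i=1..k. d i * t i j)" by blast
      then have "\<forall>j\<in>{1..k}. Poly_Mapping.lookup (a \<otimes>\<^bsub>?F\<^esub> b) j = (\<Sum>i=1..k. (c i + d i) * t i j)"
        by (simp add: lookup_add distrib_right sum.distrib)
      then show ?case by (rule exI[of _ "\<lambda>i. c i + d i"])
    qed
  qed
  show "a \<in> relation_subgroup k t"
    if asm: "Poly_Mapping.keys a \<subseteq> {1..k} \<and> (\<exists>c. \<forall>j\<in>{1..k}. Poly_Mapping.lookup a j = (\<Sum>i=1..k. c i * t i j))"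
  proof -
    obtain c where c: "\<forall>j\<in>{1..k}. Poly_Mapping.lookup a j = (\<Sum>i=1..k. c i * t i j)" using asm by blast
    have "(\<Sum>i\<in>I. frag_cmul (c i) (?row i)) \<in> relation_subgroup k t" if "finite I" "I \<subseteq> {1..k}" for I
      using that
    proof (induction I)
      case empty
      show ?case using subgroup.one_closed[OF sub] by simp
    next
      case (insert i I)
      have "?row i \<in> relation_subgroup k t"
        unfolding relation_subgroup_def using insert.prems by (intro generate.incl) auto
      from F.subgroup_int_pow_closed[OF sub this, of "c i"]
      have "frag_cmul (c i) (?row i) \<in> relation_subgroup k t"
        by (simp only: int_pow_free_Abelian_group[OF keys_row])
      then show ?case
        using insert subgroup.m_closed[OF sub] by simp
    qed
    then have "(\<Sum>i=1..k. frag_cmul (c i) (?row i)) \<in> relation_subgroup k t" by blast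
    moreover have "a = (\<Sum>i=1..k. frag_cmul (c i) (?row i))"
    proof (rule poly_mapping_eqI)
      fix j
      show "Poly_Mapping.lookup a j = Poly_Mapping.lookup (\<Sum>i=1..k. frag_cmul (c i) (?row i)) j"
      proof (cases "j \<in> {1..k}")
        case True
        then show ?thesis
          using c unfolding lookup_sum[of "\<lambda>i. frag_cmul (c i) (?row i)"] lookup_frag_cmul lookup_row
          by (simp only: if_True)
      next
        case False
        then have "j \<notin> Poly_Mapping.keys a" using asm by blast
        then have "Poly_Mapping.lookup a j = 0" by (simp only: in_keys_iff not_not)
        then show ?thesis
          using False unfolding lookup_sum[of "\<lambda>i. frag_cmul (c i) (?row i)"] lookup_frag_cmul lookup_row
          by (simp only: if_False mult_zero_right sum.neutral_const)
      qed
    qed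
    ultimately show ?thesis by simp
  qed
qed

text \<open>Apart from the cut condition added in \<open>presented_group_structure\<close>, balance
  is all that the algebra takes from the sphere.\<close>

locale balanced_counts =
  fixes k z :: nat and n :: "nat \<Rightarrow> nat \<Rightarrow> nat"
  assumes z: "z \<in> {1..k}"
    and balanced: "v \<in> {1..k} \<Longrightarrow> (\<Sum>i=1..k. n i v) = (\<Sum>j=1..k. n v j)"
begin

abbreviation "t \<equiv> t_matrix k n"
abbreviation "F \<equiv> free_Abelian_group {1..k}"
abbreviation "N \<equiv> relation_subgroup k t"
abbreviation "L \<equiv> rooted_laplacian k n z"
abbreviation "coeff_sum a \<equiv> \<Sum>i=1..k. Poly_Mapping.lookup a i"

lemma t_row_sum: "i \<in> {1..k} \<Longrightarrow> (\<Sum>j=1..k. t i j) = 0"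
  by (subst sum.remove[of _ i]) (auto simp: t_matrix_def intro!: sum.cong)

lemma t_column_sum:
  assumes "j \<in> {1..k}"
  shows "(\<Sum>i=1..k. t i j) = 0"
proof -
  have "(\<Sum>i=1..k. int (n i j)) = (\<Sum>l=1..k. int (n j l))"
    using balanced[OF assms] by (metis of_nat_sum)
  then have "(\<Sum>i\<in>{1..k} - {j}. int (n i j)) = (\<Sum>l\<in>{1..k} - {j}. int (n j l))"
    using assms by (simp add: sum.remove[of _ j])
  moreover have "(\<Sum>i=1..k. t i j) = t j j + (\<Sum>i\<in>{1..k} - {j}. int (n i j))"
    using assms by (subst sum.remove[of _ j]) (auto simp: t_matrix_def intro!: sum.cong)
  ultimately show ?thesis by (simp add: t_matrix_def)
qed

lemma rooted_laplacian_t: "i \<noteq> z \<Longrightarrow> L i j = - t i j"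
  by (simp add: rooted_laplacian_def t_matrix_def)

lemma rooted_laplacian_row_sum:
  assumes "i \<in> {1..k}"
  shows "(\<Sum>j=1..k. L i j) = of_bool (i = z)"
proof (cases "i = z")
  case True
  have "(\<Sum>j=1..k. L i j) = (\<Sum>j=1..k. if z = j then 1 else 0)"
    by (rule sum.cong) (auto simp: rooted_laplacian_def True)
  also have "\<dots> = 1" using z by (subst sum.delta') auto
  finally show ?thesis using True by simp
next
  case False
  then show ?thesis using t_row_sum[OF assms] by (simp add: rooted_laplacian_t sum_negf)
qed

abbreviation "rlat \<equiv> row_lattice k (\<lambda>i j. L (Suc i) (Suc j))"

lemma lattice_iff:
  "(\<lambda>j. v (Suc j)) \<in> rlat \<longleftrightarrow> (\<exists>c. \<forall>j\<in>{1..k}. v j = (\<Sum>i=1..k. c i * L i j))"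
proof
  assume "(\<lambda>j. v (Suc j)) \<in> rlat"
  then obtain c where c: "\<forall>j<k. v (Suc j) = (\<Sum>i<k. c i * L (Suc i) (Suc j))"
    by (auto simp: row_lattice_def)
  have "v j = (\<Sum>i=1..k. c (i - 1) * L i j)" if "j \<in> {1..k}" for j
  proof -
    obtain j' where j': "j = Suc j'" "j' < k" using \<open>j \<in> {1..k}\<close> by (cases j) auto
    then show ?thesis using c by (simp add: sum.atLeast1_atMost_eq)
  qed
  then show "\<exists>c. \<forall>j\<in>{1..k}. v j = (\<Sum>i=1..k. c i * L i j)"
    by (intro exI[of _ "\<lambda>i. c (i - 1)"]) blast
next
  assume "\<exists>c. \<forall>j\<in>{1..k}. v j = (\<Sum>i=1..k. c i * L i j)"
  then obtain c where c: "\<forall>j\<in>{1..k}. v j = (\<Sum>i=1..k. c i * L i j)" by blast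
  have "\<forall>j<k. v (Suc j) = (\<Sum>i<k. c (Suc i) * L (Suc i) (Suc j))"
  proof (intro allI impI)
    fix j assume "j < k"
    then have "Suc j \<in> {1..k}" by simp
    from bspec[OF c this] show "v (Suc j) = (\<Sum>i<k. c (Suc i) * L (Suc i) (Suc j))"
      by (simp add: sum.atLeast1_atMost_eq)
  qed
  then show "(\<lambda>j. v (Suc j)) \<in> rlat" unfolding row_lattice_def by (intro CollectI exI[of _ "\<lambda>i. c (Suc i)"])
qed

text \<open>
  By balance, row \<open>z\<close> of \<open>t\<close> is minus the sum of the other rows, so replacing it by the unit vector at \<open>z\<close>
  enlarges the lattice exactly by the multiples of that vector.
\<close>

lemma relation_subgroup_lattice_iff:
  assumes keys: "Poly_Mapping.keys a \<subseteq> {1..k}"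
  shows "a \<in> N \<longleftrightarrow> coeff_sum a = 0 \<and> (\<lambda>j. Poly_Mapping.lookup a (Suc j)) \<in> rlat"
proof
  assume "a \<in> N"
  then obtain c where c: "\<forall>j\<in>{1..k}. Poly_Mapping.lookup a j = (\<Sum>i=1..k. c i * t i j)"
    unfolding relation_subgroup_iff by blast
  have "coeff_sum a = (\<Sum>j=1..k. \<Sum>i=1..k. c i * t i j)" using c by (intro sum.cong) auto
  also have "\<dots> = (\<Sum>i=1..k. c i * (\<Sum>j=1..k. t i j))"
    unfolding sum_distrib_left by (rule sum.swap)
  also have "\<dots> = 0" using t_row_sum by simp
  finally have "coeff_sum a = 0" .
  \<comment> \<open>The columns of \<open>t\<close> sum to zero, so subtracting \<open>c z\<close>
    from every coefficient changes nothing and removes row \<open>z\<close>. The sign comes from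
    \<open>L\<close> being minus \<open>t\<close> in the other rows.\<close>
  moreover have "Poly_Mapping.lookup a j = (\<Sum>i=1..k. (c z - c i) * L i j)" if j: "j \<in> {1..k}" for j
  proof -
    have "(c z - c i) * L i j = (c i - c z) * t i j" for i
      by (cases "i = z") (simp_all add: rooted_laplacian_t algebra_simps)
    then have "(\<Sum>i=1..k. (c z - c i) * L i j) = (\<Sum>i=1..k. (c i - c z) * t i j)" by simp
    also have "\<dots> = (\<Sum>i=1..k. c i * t i j) - c z * (\<Sum>i=1..k. t i j)"
      by (simp add: left_diff_distrib sum_subtractf sum_distrib_left)
    finally show ?thesis using t_column_sum[OF j] c j by simp
  qed
  ultimately show "coeff_sum a = 0 \<and> (\<lambda>j. Poly_Mapping.lookup a (Suc j)) \<in> rlat"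
    unfolding lattice_iff[of "Poly_Mapping.lookup a"] by (intro conjI exI[of _ "\<lambda>i. c z - c i"] ballI)
next
  assume asm: "coeff_sum a = 0 \<and> (\<lambda>j. Poly_Mapping.lookup a (Suc j)) \<in> rlat"
  then obtain c where c: "\<forall>j\<in>{1..k}. Poly_Mapping.lookup a j = (\<Sum>i=1..k. c i * L i j)"
    unfolding lattice_iff[of "Poly_Mapping.lookup a"] by blast
  \<comment> \<open>Row \<open>z\<close> of \<open>L\<close> sums to 1 and the others to 0, so the
    coefficient sum of \<open>a\<close> is the multiple of the unit row used.\<close>
  have "coeff_sum a = (\<Sum>j=1..k. \<Sum>i=1..k. c i * L i j)" using c by (intro sum.cong) auto
  also have "\<dots> = (\<Sum>i=1..k. c i * (\<Sum>j=1..k. L i j))"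
    unfolding sum_distrib_left by (rule sum.swap)
  also have "\<dots> = (\<Sum>i=1..k. if i = z then c i else 0)"
  proof (rule sum.cong[OF refl])
    fix i assume "i \<in> {1..k}"
    from rooted_laplacian_row_sum[OF this]
    show "c i * (\<Sum>j=1..k. L i j) = (if i = z then c i else 0)" by (simp only:) simp
  qed
  also have "\<dots> = c z" using z by (subst sum.delta) auto
  finally have cz: "c z = 0" using asm by simp
  have "Poly_Mapping.lookup a j = (\<Sum>i=1..k. (- c i) * t i j)" if j: "j \<in> {1..k}" for j
  proof -
    have "c i * L i j = (- c i) * t i j" for i
      using cz rooted_laplacian_t[of i j] by (cases "i = z") auto
    then show ?thesis using c j by simp
  qed
  then show "a \<in> N"
    unfolding relation_subgroup_iff using keys by (intro conjI exI[of _ "\<lambda>i. - c i"] ballI)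
qed

lemma unit_at_root_in_lattice: "(\<lambda>j. s * of_bool (Suc j = z)) \<in> rlat"
proof -
  have "\<forall>j\<in>{1..k}. s * of_bool (j = z) = (\<Sum>i=1..k. (if i = z then s else 0) * L i j)"
  proof
    fix j
    have "(\<Sum>i=1..k. (if i = z then s else 0) * L i j) = (\<Sum>i=1..k. if i = z then s * L z j else 0)"
      by (rule sum.cong) auto
    also have "\<dots> = s * L z j" using z by (subst sum.delta) auto
    finally show "s * of_bool (j = z) = (\<Sum>i=1..k. (if i = z then s else 0) * L i j)"
      by (cases "j = z") (simp_all add: rooted_laplacian_def)
  qed
  then show ?thesis
    unfolding lattice_iff[of "\<lambda>j. s * of_bool (j = z)"] by (rule exI[of _ "\<lambda>i. if i = z then s else 0"])
qed

lemma subgroup_N: "subgroup N F"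
  unfolding relation_subgroup_def
proof (rule group.generate_is_subgroup)
  show "(\<lambda>i. \<Sum>j=1..k. frag_cmul (t i j) (frag_of j)) ` {1..k} \<subseteq> carrier F"
  proof (intro image_subsetI sum_closed_free_Abelian_group)
    fix i j assume "j \<in> {1..k}"
    then show "frag_cmul (t i j) (frag_of j) \<in> carrier F"
      using keys_cmul[of "t i j" "frag_of j"] by auto
  qed
qed simp

lemma coset_eq_iff:
  assumes "a \<in> carrier F" "b \<in> carrier F"
  shows "N #>\<^bsub>F\<^esub> a = N #>\<^bsub>F\<^esub> b \<longleftrightarrow> a - b \<in> N"
proof -
  interpret F: comm_group F by (rule abelian_free_Abelian_group)
  have "a \<in> N #>\<^bsub>F\<^esub> b \<longleftrightarrow> a \<otimes>\<^bsub>F\<^esub> inv\<^bsub>F\<^esub> b \<in> N"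
    by (rule subgroup.rcos_module[OF subgroup_N F.is_group assms(2,1)])
  also have "a \<otimes>\<^bsub>F\<^esub> inv\<^bsub>F\<^esub> b = a - b" using assms(2) by simp
  finally have "a \<in> N #>\<^bsub>F\<^esub> b \<longleftrightarrow> a - b \<in> N" .
  then show ?thesis
    using F.repr_independence[OF _ assms(2) subgroup_N, of a] F.rcos_self[OF assms(1) subgroup_N] by metis
qed

lemma presented_group_structure:
  assumes cut: "\<And>A. \<lbrakk>A \<subseteq> {1..k}; A \<noteq> {}; z \<notin> A\<rbrakk> \<Longrightarrow> \<exists>i\<in>A. \<exists>j\<in>{1..k} - A. 0 < n i j"
  defines "d \<equiv> tree_number (count_digraph k n) z"
  shows "d \<noteq> 0" and "\<exists>\<phi> \<in> hom (presented_group k t) integer_group.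
       (\<forall>a \<in> carrier F. \<phi> (N #>\<^bsub>F\<^esub> a) = coeff_sum a) \<and>
       (let K = (presented_group k t)\<lparr>carrier := kernel (presented_group k t) integer_group \<phi>\<rparr> in
          comm_group K \<and> finite (carrier K) \<and> order K = d \<and>
          presented_group k t \<cong> integer_group \<times>\<times> K)"
proof -
  interpret F: comm_group F by (rule abelian_free_Abelian_group)
  have det: "row_det k (\<lambda>i j. L (Suc i) (Suc j)) = int d"
    using node_det_eq_tree_number[OF z, of n] by (simp add: node_det_def d_def)
  have "int d \<noteq> 0"
    unfolding det[symmetric] using node_det_rooted_laplacian_nonzero[OF z cut] by (simp add: node_det_def)
  then show "d \<noteq> 0" by simp
  let ?B = "presented_group k t"
  have B: "?B = F Mod N" by (simp add: presented_group_def)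
  interpret B: comm_group ?B unfolding B by (rule F.abelian_FactGroup[OF subgroup_N])
  have sum_hom: "coeff_sum \<in> hom F integer_group"
    by (rule homI) (simp_all add: lookup_add sum.distrib)
  then have "group_hom F integer_group coeff_sum"
    by (intro group_hom.intro group_hom_axioms.intro) auto
  moreover have "N \<lhd> F" by (rule F.subgroup_imp_normal[OF subgroup_N])
  moreover have "N \<subseteq> kernel F integer_group coeff_sum"
  proof
    fix a assume a: "a \<in> N"
    then have "a \<in> carrier F" using subgroup.mem_carrier[OF subgroup_N] by blast
    then show "a \<in> kernel F integer_group coeff_sum"
      using a relation_subgroup_lattice_iff[of a] by (simp add: kernel_def)
  qed
  ultimately obtain \<phi> where \<phi>: "\<phi> \<in> hom (F Mod N) integer_group"
    "\<And>a. a \<in> carrier F \<Longrightarrow> \<phi> (N #>\<^bsub>F\<^esub> a) = coeff_sum a"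
    by (rule group_hom.FactGroup_universal_kernel) (rule that)
  let ?ker = "kernel ?B integer_group \<phi>"
  let ?K = "?B\<lparr>carrier := ?ker\<rparr>"
  have \<phi>B: "\<phi> \<in> hom ?B integer_group" using \<phi>(1) by (simp add: B)
  have "group_hom ?B integer_group \<phi>"
    using \<phi>B by (intro group_hom.intro group_hom_axioms.intro) auto
  then have ker_sub: "subgroup ?ker ?B" by (rule group_hom.subgroup_kernel)
  have "comm_group ?K"
  proof (rule group.group_comm_groupI)
    show "Group.group ?K" by (rule B.subgroup_imp_group[OF ker_sub])
    show "x \<otimes>\<^bsub>?K\<^esub> y = y \<otimes>\<^bsub>?K\<^esub> x" if "x \<in> carrier ?K" "y \<in> carrier ?K" for x y
      using that subgroup.mem_carrier[OF ker_sub] by (simp add: B.m_comm)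
  qed
  obtain X where X: "finite X" "int (card X) = \<bar>int d\<bar>"
    "\<And>v. \<exists>!x. x \<in> X \<and> (\<lambda>j. v j - x j) \<in> rlat"
    using row_lattice_representatives[of k "\<lambda>i j. L (Suc i) (Suc j)"] \<open>int d \<noteq> 0\<close> unfolding det by blast
  \<comment> \<open>A vector becomes an element of coefficient sum zero by subtracting its sum at
    \<open>z\<close>. This changes it by a multiple of the unit vector at \<open>z\<close>, which
    lies in \<open>rlat\<close>, so its class modulo \<open>rlat\<close> is kept.\<close>
  define lift :: "(nat \<Rightarrow> int) \<Rightarrow> nat \<Rightarrow>\<^sub>0 int" where
    "lift x = (\<Sum>j=1..k. frag_cmul (x (j - 1)) (frag_of j)) - frag_cmul (\<Sum>j=1..k. x (j - 1)) (frag_of z)" for x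
  have lookup_lift: "Poly_Mapping.lookup (lift x) j
      = (if j \<in> {1..k} then x (j - 1) else 0) - (\<Sum>j=1..k. x (j - 1)) * of_bool (j = z)" for x j
    by (simp add: lift_def lookup_minus lookup_sum if_distrib[of "(*) _"] sum.delta' of_bool_def cong: if_cong)
  have lift_F: "lift x \<in> carrier F" for x
  proof -
    have "Poly_Mapping.lookup (lift x) j = 0" if "j \<notin> {1..k}" for j
      using that z unfolding lookup_lift by auto
    then show ?thesis by (metis carrier_free_Abelian_group_iff in_keys_iff subsetI)
  qed
  have sum_lift: "coeff_sum (lift x) = 0" for x
  proof -
    have "coeff_sum (lift x) = (\<Sum>j=1..k. x (j - 1)) - (\<Sum>j=1..k. if j = z then \<Sum>j=1..k. x (j - 1) else 0)"
      unfolding sum_subtractf[symmetric] lookup_lift by (rule sum.cong) auto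
    also have "\<dots> = 0" using z by (subst sum.delta) auto
    finally show ?thesis .
  qed
  \<comment> \<open>For \<open>a\<close> itself a lift this yields injectivity of the map from
    \<open>X\<close> to cosets, for \<open>a\<close> of coefficient sum zero its surjectivity onto
    the kernel.\<close>
  have diff_N: "a - lift x \<in> N \<longleftrightarrow> coeff_sum a = 0 \<and> (\<lambda>j. Poly_Mapping.lookup a (Suc j) - x j) \<in> rlat"
    if a: "a \<in> carrier F" for a x
  proof -
    define s where "s = (\<Sum>j=1..k. x (j - 1))"
    have mem: "a - lift x \<in> carrier F"
      using F.m_closed[OF a F.inv_closed[OF lift_F[of x]]] lift_F[of x] by simp
    have "coeff_sum (a - lift x) = coeff_sum a" using sum_lift[of x] by (simp add: lookup_minus sum_subtractf)
    moreover have "(\<lambda>j. Poly_Mapping.lookup (a - lift x) (Suc j)) \<in> rlat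
      \<longleftrightarrow> (\<lambda>j. Poly_Mapping.lookup a (Suc j) - x j) \<in> rlat" (is "?u \<in> _ \<longleftrightarrow> ?w \<in> _")
    proof -
      have uw: "?u j = ?w j + s * of_bool (Suc j = z)" if "j < k" for j
        using that by (simp add: lookup_minus lookup_lift s_def)
      have cong: "u \<in> rlat \<longleftrightarrow> w \<in> rlat" if "\<And>j. j < k \<Longrightarrow> u j = w j" for u w
        unfolding row_lattice_def using that by simp
      have "?u \<in> rlat \<longleftrightarrow> (\<lambda>j. ?w j - (- s) * of_bool (Suc j = z)) \<in> rlat"
        by (rule cong) (simp add: uw)
      moreover have "?w \<in> rlat \<longleftrightarrow> (\<lambda>j. ?u j - s * of_bool (Suc j = z)) \<in> rlat"
        by (rule cong) (simp add: uw)
      ultimately show ?thesis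
        using row_lattice_diff[OF _ unit_at_root_in_lattice[of s], of ?u]
          row_lattice_diff[OF _ unit_at_root_in_lattice[of "- s"], of ?w] by argo
    qed
    ultimately show ?thesis using relation_subgroup_lattice_iff[of "a - lift x"] mem by simp
  qed
  have "bij_betw (\<lambda>x. N #>\<^bsub>F\<^esub> lift x) X ?ker"
    unfolding bij_betw_def
  proof
    show "inj_on (\<lambda>x. N #>\<^bsub>F\<^esub> lift x) X"
    proof (rule inj_onI)
      fix x y assume xy: "x \<in> X" "y \<in> X" "N #>\<^bsub>F\<^esub> lift x = N #>\<^bsub>F\<^esub> lift y"
      let ?v = "\<lambda>j. Poly_Mapping.lookup (lift x) (Suc j)"
      have "lift x - lift y \<in> N" using xy(3) coset_eq_iff[OF lift_F lift_F] by simp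
      then have "(\<lambda>j. ?v j - y j) \<in> rlat" using diff_N[OF lift_F] by blast
      moreover have "lift x - lift x \<in> N" using subgroup.one_closed[OF subgroup_N] by simp
      then have "(\<lambda>j. ?v j - x j) \<in> rlat" using diff_N[OF lift_F] by blast
      ultimately show "x = y" using X(3)[of ?v] xy(1,2) by blast
    qed
    show "(\<lambda>x. N #>\<^bsub>F\<^esub> lift x) ` X = ?ker"
    proof (intro equalityI subsetI)
      fix c assume "c \<in> (\<lambda>x. N #>\<^bsub>F\<^esub> lift x) ` X"
      then obtain x where "c = N #>\<^bsub>F\<^esub> lift x" by blast
      then show "c \<in> ?ker"
        using \<phi>(2)[OF lift_F] sum_lift lift_F[of x] by (auto simp: kernel_def B carrier_FactGroup)
    next
      fix c assume c: "c \<in> ?ker"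
      then obtain a where a: "a \<in> carrier F" "c = N #>\<^bsub>F\<^esub> a" by (auto simp: kernel_def B carrier_FactGroup)
      have "coeff_sum a = 0" using c \<phi>(2)[OF a(1)] a(2) by (simp add: kernel_def)
      moreover obtain x where x: "x \<in> X" "(\<lambda>j. Poly_Mapping.lookup a (Suc j) - x j) \<in> rlat"
        using X(3)[of "\<lambda>j. Poly_Mapping.lookup a (Suc j)"] by blast
      ultimately have "a - lift x \<in> N" using diff_N[OF a(1)] by blast
      then have "c = N #>\<^bsub>F\<^esub> lift x" using coset_eq_iff[OF a(1) lift_F] a(2) by simp
      then show "c \<in> (\<lambda>x. N #>\<^bsub>F\<^esub> lift x) ` X" using x(1) by blast
    qed
  qed
  then have "finite ?ker" "card ?ker = d"
    using X(1,2) bij_betw_finite bij_betw_same_card by fastforce+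
  \<comment> \<open>The class of the generator at \<open>z\<close> has coefficient sum 1 and
    provides the section.\<close>
  moreover have "?B \<cong> integer_group \<times>\<times> ?K"
  proof (rule B.split_over_integers[OF \<phi>B])
    show "N #>\<^bsub>F\<^esub> frag_of z \<in> carrier ?B" using z by (auto simp: B carrier_FactGroup)
    have "coeff_sum (frag_of z) = 1" using z by (simp add: sum.delta)
    then show "\<phi> (N #>\<^bsub>F\<^esub> frag_of z) = 1" using \<phi>(2)[of "frag_of z"] z by simp
  qed
  ultimately show "\<exists>\<phi> \<in> hom (presented_group k t) integer_group.
       (\<forall>a \<in> carrier F. \<phi> (N #>\<^bsub>F\<^esub> a) = coeff_sum a) \<and>
       (let K = (presented_group k t)\<lparr>carrier := kernel (presented_group k t) integer_group \<phi>\<rparr> in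
          comm_group K \<and> finite (carrier K) \<and> order K = d \<and>
          presented_group k t \<cong> integer_group \<times>\<times> K)"
    using \<phi>(2) \<open>comm_group ?K\<close> by (intro bexI[OF _ \<phi>B]) (simp add: Let_def order_def)
qed

end

section \<open>The cut condition for the sphere\<close>

context numbered_sphere begin

lemma balanced_counts: "z \<in> {1..k} \<Longrightarrow> balanced_counts k z n"
  by (intro balanced_counts.intro t_count_balanced)

text \<open>By balance, as many arcs leave \<open>A\<close> as enter it.\<close>

lemma t_count_cut_in:
  assumes A: "A \<subseteq> {1..k}" "A \<noteq> {}" "A \<noteq> {1..k}"
  shows "\<exists>i\<in>A. \<exists>j\<in>{1..k} - A. 0 < n i j"
proof (rule ccontr)
  assume none: "\<not> (\<exists>i\<in>A. \<exists>j\<in>{1..k} - A. 0 < n i j)"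
  have finA: "finite A" using A(1) finite_subset by blast
  have split_sum: "sum f {1..k} = sum f A + sum f ({1..k} - A)" for f :: "nat \<Rightarrow> nat"
    using sum.subset_diff[OF A(1), of f] by simp
  have "(\<Sum>v\<in>A. \<Sum>i=1..k. n i v) = (\<Sum>v\<in>A. \<Sum>j=1..k. n v j)"
  proof (rule sum.cong[OF refl])
    fix v assume "v \<in> A"
    then show "(\<Sum>i=1..k. n i v) = (\<Sum>j=1..k. n v j)" using A(1) by (intro t_count_balanced) blast
  qed
  \<comment> \<open>Pairs inside \<open>A\<close> cancel, so that the arcs leaving \<open>A\<close>
    remain on the left and those entering it on the right.\<close>
  moreover have "(\<Sum>v\<in>A. \<Sum>i\<in>A. n i v) = (\<Sum>v\<in>A. \<Sum>j\<in>A. n v j)"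
    by (rule sum.swap)
  ultimately have "(\<Sum>v\<in>A. \<Sum>i\<in>{1..k} - A. n i v) = (\<Sum>v\<in>A. \<Sum>j\<in>{1..k} - A. n v j)"
    unfolding split_sum sum.distrib by linarith
  also have "\<dots> = 0" using none by (intro sum.neutral ballI) (metis gr0I)
  finally have "\<forall>v\<in>A. \<forall>i\<in>{1..k} - A. n i v = 0" using finA by (simp only: sum_eq_0_iff finite_Diff finite_atLeastAtMost)
  then show False using t_count_cut[OF A] none by (metis less_irrefl)
qed

end

theorem theorem7:
  fixes V R C S :: "(real^3) set" and E Wh Bl :: "(real^3) set set"
    and r :: "nat \<Rightarrow> real^3" and k z :: nat
  assumes "sphere_triangulation V E"
    and "proper_face_2_colouring V E Wh Bl"
    and "proper_vertex_3_colouring V E R C S"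
    and "bij_betw r {1..k} R"
    and "z \<in> {1..k}"
  defines "n \<equiv> t_count V E Wh Bl C S r"
  defines "t \<equiv> t_matrix k n"
  defines "B\<^sub>W \<equiv> presented_group k t"
  defines "d \<equiv> tree_number (count_digraph k n) z"
  shows "d \<noteq> 0 \<and>
    (\<exists>\<phi> \<in> hom B\<^sub>W integer_group.
       (\<forall>a \<in> carrier (free_Abelian_group {1..k}).
          \<phi> (relation_subgroup k t #>\<^bsub>free_Abelian_group {1..k}\<^esub> a)
            = (\<Sum>i=1..k. Poly_Mapping.lookup a i)) \<and>
       (let K = B\<^sub>W\<lparr>carrier := kernel B\<^sub>W integer_group \<phi>\<rparr> in
          comm_group K \<and> finite (carrier K) \<and> order K = d \<and>
          B\<^sub>W \<cong> integer_group \<times>\<times> K))"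
proof -
  interpret numbered_sphere V E Wh Bl R C S r k
    by unfold_locales (fact assms)+
  interpret balanced_counts k z "t_count V E Wh Bl C S r"
    by (rule balanced_counts) fact
  have cut: "\<exists>i\<in>A. \<exists>j\<in>{1..k} - A. 0 < t_count V E Wh Bl C S r i j"
    if "A \<subseteq> {1..k}" "A \<noteq> {}" "z \<notin> A" for A
    using t_count_cut_in[of A] that assms(5) by blast
  show ?thesis
    unfolding d_def B\<^sub>W_def t_def n_def
    using presented_group_structure[OF cut] by (rule conjI)
qed

end
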